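(* For every integer $n\ge 1$, the space $\mathcal{F}_{2n,n}^{\mathbb{C}}$ of $2n$-vector unit-norm tight frames in an $n$-dimensional complex Hilbert space is connected.
   Context: For $k\ge n\ge 1$, a finite unit-norm tight frame with $k$ vectors in an $n$-dimensional Hilbert space $\mathcal{H}$ is a sequence $(x_1,\dots,x_k)$ of unit vectors of $\mathcal{H}$ such that $y=\frac{n}{k}\sum_{j=1}^{k}\langle y,x_j\rangle x_j$ for all $y\in\mathcal{H}$. $\mathcal{F}_{k,n}^{\mathbb{C}}$ denotes the set of all such sequences when $\mathcal{H}$ is complex, with the topology inherited from $\mathcal{H}^k$. *)

theory Defs
  imports "HOL-Analysis.Analysis"
begin

class complex_inner = real_normed_vector +
  fixes scaleC :: "complex \<Rightarrow> 'a \<Rightarrow> 'a" (infixr "*\<^sub>C" 75)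
    and cinner :: "'a \<Rightarrow> 'a \<Rightarrow> complex"
  assumes scaleC_add_right: "a *\<^sub>C (x + y) = a *\<^sub>C x + a *\<^sub>C y"
    and scaleC_add_left: "(a + b) *\<^sub>C x = a *\<^sub>C x + b *\<^sub>C x"
    and scaleC_scaleC: "a *\<^sub>C b *\<^sub>C x = (a * b) *\<^sub>C x"
    and scaleC_one: "1 *\<^sub>C x = x"
    and scaleR_scaleC: "r *\<^sub>R x = complex_of_real r *\<^sub>C x"
    and cinner_commute: "cinner x y = cnj (cinner y x)"
    and cinner_add_left: "cinner (x + y) z = cinner x z + cinner y z"
    and cinner_scaleC_left: "cinner (a *\<^sub>C x) y = a * cinner x y"
    and cinner_self_nonneg: "0 \<le> Re (cinner x x)"
    and cinner_self_eq_zero: "cinner x x = 0 \<longleftrightarrow> x = 0"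
    and norm_eq_sqrt_cinner: "norm x = sqrt (Re (cinner x x))"

class complex_hilbert = complex_inner + complete_space

text \<open>\<open>complex_dim UNIV\<close> is \<open>0\<close> for an infinite-dimensional space, so
  \<open>complex_dim UNIV = n\<close> with \<open>n \<ge> 1\<close> implies finite dimension.\<close>

global_interpretation complex_vector: vector_space
  "scaleC :: complex \<Rightarrow> 'a \<Rightarrow> 'a::complex_inner"
  defines complex_dim = complex_vector.dim
  by unfold_locales
    (simp_all add: scaleC_add_right scaleC_add_left scaleC_scaleC scaleC_one)

text \<open>Finite products of \<open>complex\<close>, showing that every dimension \<open>n \<ge> 1\<close> occurs.\<close>

instantiation complex :: complex_hilbert
begin

definition scaleC_complex :: "complex \<Rightarrow> complex \<Rightarrow> complex"
  where "scaleC_complex a x = a * x"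

definition cinner_complex :: "complex \<Rightarrow> complex \<Rightarrow> complex"
  where "cinner_complex x y = x * cnj y"

instance
proof
  fix x y :: complex
  show "cinner x y = cnj (cinner y x)"
    by (simp add: cinner_complex_def mult.commute)
  show "norm x = sqrt (Re (cinner x x))"
    by (simp add: cinner_complex_def cmod_def power2_eq_square)
qed (simp_all add: scaleC_complex_def cinner_complex_def algebra_simps scaleR_conv_of_real)

end

instantiation vec :: (complex_hilbert, finite) complex_hilbert
begin

definition scaleC_vec :: "complex \<Rightarrow> 'a ^ 'b \<Rightarrow> 'a ^ 'b"
  where "scaleC_vec a x = (\<chi> i. a *\<^sub>C x $ i)"

definition cinner_vec :: "'a ^ 'b \<Rightarrow> 'a ^ 'b \<Rightarrow> complex"
  where "cinner_vec x y = (\<Sum>i\<in>UNIV. cinner (x $ i) (y $ i))"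

instance
proof
  fix x y z :: "'a ^ 'b" and a b :: complex and r :: real
  show "cinner x y = cnj (cinner y x)"
    unfolding cinner_vec_def cnj_sum by (rule sum.cong[OF refl], rule cinner_commute)
  have Im0: "Im (cinner u u) = 0" for u :: 'a
    using arg_cong[OF cinner_commute[of u u], of Im] by simp
  have eq: "cinner u u = complex_of_real ((norm u)\<^sup>2)" for u :: 'a
    by (rule complex_eqI) (simp_all add: Im0 norm_eq_sqrt_cinner cinner_self_nonneg)
  have eqv: "cinner x x = complex_of_real (\<Sum>i\<in>UNIV. (norm (x $ i))\<^sup>2)"
    by (simp add: cinner_vec_def eq)
  show "0 \<le> Re (cinner x x)"
    unfolding eqv Re_complex_of_real by (intro sum_nonneg) simp
  show "cinner x x = 0 \<longleftrightarrow> x = 0"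
    unfolding eqv of_real_eq_0_iff by (subst sum_nonneg_eq_0_iff) (auto simp: vec_eq_iff)
  show "norm x = sqrt (Re (cinner x x))"
    unfolding eqv Re_complex_of_real by (simp add: norm_vec_def L2_set_def)
qed (auto simp: scaleC_vec_def cinner_vec_def vec_eq_iff scaleC_add_right scaleC_add_left
    scaleC_scaleC scaleC_one scaleR_scaleC cinner_add_left cinner_scaleC_left
    sum.distrib sum_distrib_left)

end

lemma complex_dim_vec: "complex_dim (UNIV :: (complex ^ 'n) set) = CARD('n)"
proof -
  have "(scaleC :: complex \<Rightarrow> complex ^ 'n \<Rightarrow> complex ^ 'n) = (*s)"
    by (simp add: fun_eq_iff vec_eq_iff scaleC_vec_def scaleC_complex_def)
  then show ?thesis
    by (simp add: complex_dim_def vec.dim_UNIV card_cart_basis)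
qed

text \<open>Sequences \<open>(x\<^sub>1, \<dots>, x\<^sub>k)\<close> are extensional functions on \<open>{1..k}\<close>, the points of
  \<open>product_topology (\<lambda>_. euclidean) {1..k}\<close>, which is the topology of the \<open>k\<close>-fold power.
  The inner product is linear in its first argument.\<close>

definition unit_norm_tight_frames :: "nat \<Rightarrow> (nat \<Rightarrow> 'a::complex_hilbert) set"
  where "unit_norm_tight_frames k =
    {x \<in> {1..k} \<rightarrow>\<^sub>E UNIV.
      (\<forall>j\<in>{1..k}. norm (x j) = 1) \<and>
      (\<forall>y. y = (of_nat (complex_dim (UNIV :: 'a set)) / of_nat k) *\<^sub>C
                 (\<Sum>j=1..k. cinner y (x j) *\<^sub>C x j))}"

end

(*
  Write u for the Gram matrix minus the identity: for a tight frame of 2n unit vectors u is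
  Hermitian, has zero diagonal, and satisfies u^2 = 1.  Two kinds of paths stay in the frame space:
  changing the phases of the vectors, and rotating two vectors into each other by
  x_i' = c x_i + w s x_j,  x_j' = c x_j - cnj w s x_i,  where the phase w makes cnj w <x_i, x_j>
  imaginary.

  On a connected component, which is compact, maximise |u_ba|.  At every maximiser, rotating b with
  j shows that u_ba u_aj u_jb is real, so after a change of phases u_ba = m > 0 and the entries
  u_aj, u_bj are real.  Rotations of pairs i, j different from a, b preserve maximisers, so this
  reality must persist; it forces Re u_ij = 0 unless (u_ai, u_bi) and (u_aj, u_bj) are parallel.
  Together with u^2 = 1 this gives |u_aj| = |u_bj| for all j at every maximiser.  If m < 1, rows a and
  b being orthogonal yields i with u_ai = u_bi and j with u_aj = - u_bj, both nonzero, and rotating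
  i, j by 45 degrees destroys the equality of moduli.  Hence m = 1, that is x_a and x_b are parallel and
  orthogonal to the remaining vectors, and one continues with those.

  Every component therefore contains an orthonormal basis with each vector repeated, and any two
  of these are linked by rotations of pairs of orthogonal vectors.
*)

theory Submission imports Defs begin

section \<open>Complex inner products\<close>

lemma cinner_scaleC_right: "cinner x (a *\<^sub>C y) = cnj a * cinner x (y::'a::complex_inner)"
  by (metis cinner_commute cinner_scaleC_left complex_cnj_mult)

lemma cinner_add_right: "cinner x (y + z) = cinner x y + cinner x (z::'a::complex_inner)"
  by (metis cinner_commute cinner_add_left complex_cnj_add)

lemma cinner_self: "cinner x x = complex_of_real ((norm (x::'a::complex_inner))\<^sup>2)"
proof -
  have "Im (cinner x x) = 0"
    using arg_cong[OF cinner_commute[of x x], of Im] by simp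
  then show ?thesis
    by (auto intro!: complex_eqI simp: norm_eq_sqrt_cinner cinner_self_nonneg)
qed

lemma norm_scaleC: "norm (a *\<^sub>C x) = cmod a * norm (x::'a::complex_inner)"
proof -
  have "cinner (a *\<^sub>C x) (a *\<^sub>C x) = (a * cnj a) * cinner x x"
    by (simp add: cinner_scaleC_left cinner_scaleC_right)
  also have "\<dots> = complex_of_real ((cmod a * norm x)\<^sup>2)"
    by (simp add: cinner_self power_mult_distrib complex_mult_cnj cmod_power2)
  finally have "(norm (a *\<^sub>C x))\<^sup>2 = (cmod a * norm x)\<^sup>2"
    by (simp add: cinner_self del: of_real_power)
  then show ?thesis by (simp add: power2_eq_iff_nonneg)
qed

lemma norm_add_squared:
  "(norm (x + y))\<^sup>2 = (norm x)\<^sup>2 + (norm y)\<^sup>2 + 2 * Re (cinner x (y::'a::complex_inner))"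
proof -
  have "Re (cinner y x) = Re (cinner x y)"
    by (subst cinner_commute) simp
  then have "Re (cinner (x + y) (x + y)) = Re (cinner x x) + Re (cinner y y) + 2 * Re (cinner x y)"
    by (simp add: cinner_add_left cinner_add_right)
  then show ?thesis by (simp add: cinner_self)
qed

lemma cnj_sgn_mult: "cnj (sgn z) * z = complex_of_real (cmod z)"
proof (cases "z = 0")
  case False
  have "cnj z * z = complex_of_real (cmod z * cmod z)"
    by (simp add: complex_norm_square[of z, symmetric] mult.commute flip: power2_eq_square)
  with False show ?thesis by (simp add: sgn_eq field_simps)
qed simp

text \<open>The triangle inequality is an axiom of the class, so Cauchy-Schwarz is drawn from it:
  expanding the squared norm of u + v bounds the real part, and multiplying x by the phase
  \<open>w\<close> makes the inner product equal to its modulus.\<close>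

lemma cmod_cinner_le: "cmod (cinner x y) \<le> norm x * norm (y::'a::complex_inner)"
proof -
  have Re_le: "Re (cinner u v) \<le> norm u * norm v" for u v :: 'a
  proof -
    have "(norm (u + v))\<^sup>2 \<le> (norm u + norm v)\<^sup>2"
      by (simp add: norm_triangle_ineq power_mono)
    then show ?thesis by (simp add: norm_add_squared power2_sum)
  qed
  define w where "w = cnj (sgn (cinner x y))"
  have "w * cinner x y = complex_of_real (cmod (cinner x y))"
    by (simp add: w_def cnj_sgn_mult)
  then have "cmod (cinner x y) = Re (cinner (w *\<^sub>C x) y)"
    by (simp add: cinner_scaleC_left)
  also have "\<dots> \<le> norm (w *\<^sub>C x) * norm y" by (rule Re_le)
  also have "\<dots> \<le> norm x * norm y"
    by (simp add: norm_scaleC w_def norm_sgn mult_right_mono)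
  finally show ?thesis .
qed

lemma bounded_bilinear_cinner: "bounded_bilinear (cinner :: 'a::complex_inner \<Rightarrow> _)"
proof
  show "\<exists>K. \<forall>x y::'a. cmod (cinner x y) \<le> norm x * norm y * K"
    by (intro exI[of _ 1]) (simp add: cmod_cinner_le)
qed (simp_all add: cinner_add_left cinner_add_right cinner_scaleC_left cinner_scaleC_right
    scaleR_scaleC scaleC_complex_def)

lemma bounded_bilinear_scaleC: "bounded_bilinear (scaleC :: complex \<Rightarrow> 'a::complex_inner \<Rightarrow> 'a)"
proof
  show "\<exists>K. \<forall>a. \<forall>x::'a. norm (a *\<^sub>C x) \<le> norm a * norm x * K"
    by (intro exI[of _ 1]) (simp add: norm_scaleC)
qed (simp_all add: scaleC_add_left scaleC_add_right scaleR_scaleC scaleC_scaleC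
    scaleR_conv_of_real scaleC_complex_def mult.commute)

interpretation cinner: bounded_bilinear "cinner :: 'a::complex_inner \<Rightarrow> _"
  by (rule bounded_bilinear_cinner)

interpretation scaleC: bounded_bilinear "scaleC :: complex \<Rightarrow> 'a::complex_inner \<Rightarrow> 'a"
  by (rule bounded_bilinear_scaleC)

section \<open>The space of tight frames with bound 2\<close>

text \<open>For 2n vectors in dimension n the frame bound is 2, so the frame condition can be stated
  without the dimension.\<close>

definition tight2 :: "'i set \<Rightarrow> ('i \<Rightarrow> 'a::complex_inner) set" where
  "tight2 I = {x \<in> I \<rightarrow>\<^sub>E UNIV. (\<forall>j\<in>I. norm (x j) = 1) \<and>
     (\<forall>y. (\<Sum>j\<in>I. cinner y (x j) *\<^sub>C x j) = 2 *\<^sub>C y)}"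

abbreviation power_topology :: "'i set \<Rightarrow> ('i \<Rightarrow> 'a::topological_space) topology" where
  "power_topology I \<equiv> product_topology (\<lambda>_. euclidean) I"

abbreviation tight2_topology :: "'i set \<Rightarrow> ('i \<Rightarrow> 'a::complex_inner) topology" where
  "tight2_topology I \<equiv> subtopology (power_topology I) (tight2 I)"

abbreviation linked :: "'i set \<Rightarrow> ('i \<Rightarrow> 'a::complex_inner) \<Rightarrow> ('i \<Rightarrow> 'a) \<Rightarrow> bool" where
  "linked I \<equiv> connected_component_of (tight2_topology I)"

lemma topspace_tight2: "topspace (tight2_topology I) = tight2 I"
  by (auto simp: tight2_def)

lemma continuous_map_component:
  assumes "i \<in> I"
  shows "continuous_map (tight2_topology I) euclidean (\<lambda>x. x i)"
  by (intro continuous_map_from_subtopology continuous_map_product_projection assms)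

lemma continuous_map_bilinear:
  assumes "bounded_bilinear h" "continuous_map X euclidean f" "continuous_map X euclidean g"
  shows "continuous_map X euclidean (\<lambda>x. h (f x) (g x))"
  using assms(2,3) by (simp add: continuous_map_atin bounded_bilinear.tendsto[OF assms(1)])

text \<open>The frame itself supplies the compactness: y is half the sum of c_j x_j with c_j = <y,
  x_j>, and |c_j| <= 1 by Cauchy-Schwarz, so the unit ball lies in a continuous image of a compact
  polydisc.\<close>

lemma unit_ball_in_compact:
  fixes x :: "'i \<Rightarrow> 'a::complex_inner"
  assumes "finite I" "x \<in> tight2 I"
  shows "\<exists>B::'a set. compact B \<and> cball 0 1 \<subseteq> B"
proof -
  let ?C = "PiE I (\<lambda>_. cball (0::complex) 1)"
  let ?f = "\<lambda>c. (1/2) *\<^sub>C (\<Sum>j\<in>I. c j *\<^sub>C x j)"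
  have "compactin (power_topology I) ?C"
    by (simp add: compactin_PiE)
  moreover have "continuous_map (power_topology I) euclidean ?f"
    by (intro continuous_map_bilinear[OF bounded_bilinear_scaleC] continuous_map_sum
        continuous_map_product_projection assms) auto
  ultimately have "compact (?f ` ?C)"
    using image_compactin by fastforce
  moreover have "cball 0 1 \<subseteq> ?f ` ?C"
  proof
    fix y :: 'a assume y: "y \<in> cball 0 1"
    have "(\<Sum>j\<in>I. cinner y (x j) *\<^sub>C x j) = 2 *\<^sub>C y"
      using assms(2) by (auto simp: tight2_def)
    then have "y = ?f (\<lambda>j\<in>I. cinner y (x j))"
      by (simp add: scaleC_scaleC scaleC_one)
    moreover have "cmod (cinner y (x j)) \<le> 1" if "j \<in> I" for j
      using cmod_cinner_le[of y "x j"] that assms(2) y by (simp add: tight2_def)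
    ultimately show "y \<in> ?f ` ?C"
      by (intro image_eqI[of _ _ "\<lambda>j\<in>I. cinner y (x j)"]) auto
  qed
  ultimately show ?thesis by blast
qed

text \<open>The frames are cut out by continuous equations and lie in a power of the compact set
  \<open>B\<close>.\<close>

lemma compact_space_tight2:
  fixes I :: "'i set"
  assumes "finite I"
  shows "compact_space (tight2_topology I :: ('i \<Rightarrow> 'a::complex_inner) topology)"
proof (cases "tight2 I = ({} :: ('i \<Rightarrow> 'a) set)")
  case True
  then show ?thesis
    by (simp add: compact_space_subtopology)
next
  case False
  let ?X = "power_topology I :: ('i \<Rightarrow> 'a) topology"
  obtain B :: "'a set" where B: "compact B" "cball 0 1 \<subseteq> B"
    using False unit_ball_in_compact[OF assms] by blast
  have comp: "continuous_map ?X euclidean (\<lambda>x. x j)" if "j \<in> I" for j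
    using that by (rule continuous_map_product_projection)
  have "closedin ?X {x \<in> topspace ?X. norm (x j) \<in> {1}}" if "j \<in> I" for j
    by (rule closedin_continuous_map_preimage[where Y = euclidean])
       (auto intro!: continuous_map_norm comp that)
  \<comment> \<open>Inserting the whole space keeps the family nonempty when \<open>I\<close> is
    empty.\<close>
  then have 1: "closedin ?X (\<Inter>(insert (topspace ?X) ((\<lambda>j. {x \<in> topspace ?X. norm (x j) \<in> {1}}) ` I)))"
    by (intro closedin_Inter) (use closedin_topspace in blast)+
  have "closedin ?X {x \<in> topspace ?X. (\<Sum>j\<in>I. cinner y (x j) *\<^sub>C x j) \<in> {2 *\<^sub>C y}}" for y
    by (rule closedin_continuous_map_preimage[where Y = euclidean])
       (auto intro!: continuous_map_sum continuous_map_bilinear[OF bounded_bilinear_scaleC]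
         continuous_map_bilinear[OF bounded_bilinear_cinner] comp assms)
  then have 2: "closedin ?X (\<Inter>(range (\<lambda>y. {x \<in> topspace ?X. (\<Sum>j\<in>I. cinner y (x j) *\<^sub>C x j) \<in> {2 *\<^sub>C y}})))"
    by (auto intro!: closedin_Inter)
  have "tight2 I = \<Inter>(insert (topspace ?X) ((\<lambda>j. {x \<in> topspace ?X. norm (x j) \<in> {1}}) ` I)) \<inter>
      \<Inter>(range (\<lambda>y. {x \<in> topspace ?X. (\<Sum>j\<in>I. cinner y (x j) *\<^sub>C x j) \<in> {2 *\<^sub>C y}}))"
    by (auto simp: tight2_def)
  with closedin_Int[OF 1 2] have "closedin ?X (tight2 I)"
    by simp
  moreover have "compactin ?X (PiE I (\<lambda>_. B))"
    using B by (simp add: compactin_PiE)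
  moreover have "tight2 I \<subseteq> PiE I (\<lambda>_. B)"
  proof
    fix x :: "'i \<Rightarrow> 'a" assume "x \<in> tight2 I"
    then have "x \<in> I \<rightarrow>\<^sub>E UNIV" "\<forall>j\<in>I. x j \<in> cball 0 1"
      by (simp_all add: tight2_def)
    with B(2) show "x \<in> PiE I (\<lambda>_. B)"
      by (auto simp: PiE_def Pi_def)
  qed
  ultimately have "compactin ?X (tight2 I)"
    using closed_compactin[of ?X "PiE I (\<lambda>_. B)" "tight2 I"] by simp
  then show ?thesis
    by (rule compact_space_subtopology)
qed

section \<open>Maximisation and paths inside a connected component\<close>

text \<open>Connected components are closed, hence compact here, so a maximum is attained without
  leaving the component of x. Closedness is automatic for connected components but not for path
  components, which is why \<open>linked\<close> is built on the former.\<close>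

lemma linked_maximizer:
  assumes "finite I" "closedin (tight2_topology I) C" "x \<in> C"
    and f: "continuous_map (tight2_topology I) euclideanreal f"
  obtains z where "z \<in> C" "linked I x z" "\<And>y. y \<in> C \<Longrightarrow> linked I x y \<Longrightarrow> f y \<le> f z"
proof -
  let ?K = "C \<inter> Collect (linked I x)"
  have x: "x \<in> topspace (tight2_topology I)"
    using assms(2,3) closedin_subset by blast
  have "closedin (tight2_topology I) ?K"
    by (intro closedin_Int assms(2) closedin_connected_component_of)
  then have "compactin (tight2_topology I) ?K"
    using closedin_compact_space compact_space_tight2[OF assms(1)] by blast
  then have "compact (f ` ?K)"
    using image_compactin[OF _ f] by simp
  moreover have "x \<in> ?K"
    using assms(3) x by (simp add: connected_component_of_refl)
  ultimately obtain s where "s \<in> f ` ?K" "\<forall>t\<in>f ` ?K. t \<le> s"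
    using compact_attains_sup[of "f ` ?K"] by blast
  then show ?thesis using that by blast
qed

lemma linked_path:
  fixes \<gamma> :: "real \<Rightarrow> 'i \<Rightarrow> 'a::complex_inner"
  assumes "\<And>t. \<gamma> t \<in> tight2 I"
    and "\<And>j. j \<in> I \<Longrightarrow> continuous_on UNIV (\<lambda>t. \<gamma> t j)"
  shows "linked I (\<gamma> s) (\<gamma> t)"
proof -
  have "continuous_map euclidean (tight2_topology I) \<gamma>"
    using assms by (auto simp: continuous_map_in_subtopology continuous_map_componentwise tight2_def PiE_def)
  then have "connectedin (tight2_topology I) (range \<gamma>)"
    using connectedin_continuous_map_image[of euclidean _ \<gamma> UNIV] by simp
  then show ?thesis
    unfolding connected_component_of_def by blast
qed

section \<open>Gram matrices, phase changes and rotations of pairs\<close>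

definition offgram :: "('i \<Rightarrow> 'a::complex_inner) \<Rightarrow> 'i \<Rightarrow> 'i \<Rightarrow> complex" where
  "offgram x i j = (if i = j then 0 else cinner (x i) (x j))"

lemma offgram_same [simp]: "offgram x i i = 0"
  by (simp add: offgram_def)

lemma offgram_commute: "offgram x i j = cnj (offgram x j i)"
  by (cases "i = j") (auto simp: offgram_def intro: cinner_commute)

lemma cmod_offgram_commute: "cmod (offgram x i j) = cmod (offgram x j i)"
  by (subst offgram_commute) simp

text \<open>Pairing the frame identity for x_i with x_j gives G^2 = 2G for the Gram matrix G, hence
  (G - 1)^2 = 1.\<close>

lemma offgram_square:
  fixes x :: "'i \<Rightarrow> 'a::complex_inner"
  assumes "finite I" "x \<in> tight2 I" "i \<in> I" "j \<in> I"
  shows "(\<Sum>k\<in>I. offgram x i k * offgram x k j) = (if i = j then 1 else 0)"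
proof -
  have unit: "cinner (x k) (x k) = 1" if "k \<in> I" for k
    using that assms(2) by (simp add: cinner_self tight2_def)
  define d where "d k l = (if k = l then 1 else 0 :: complex)" for k l :: 'i
  have dl: "(\<Sum>k\<in>I. d l k * f k) = f l" if "l \<in> I" for l f
  proof -
    have "(\<Sum>k\<in>I. d l k * f k) = (\<Sum>k\<in>I. if l = k then f k else 0)"
      by (rule sum.cong) (auto simp: d_def)
    with that assms(1) show ?thesis by simp
  qed
  have dr: "(\<Sum>k\<in>I. f k * d k l) = f l" if "l \<in> I" for l f
    using dl[OF that, of f] by (simp add: d_def mult.commute eq_commute)
  have u: "offgram x k l = cinner (x k) (x l) - d k l" if "k \<in> I" "l \<in> I" for k l
    using that unit by (auto simp: offgram_def d_def)
  have "(\<Sum>k\<in>I. cinner (x i) (x k) * cinner (x k) (x j)) = cinner (\<Sum>k\<in>I. cinner (x i) (x k) *\<^sub>C x k) (x j)"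
    by (simp add: cinner.sum_left cinner_scaleC_left)
  also have "\<dots> = 2 * cinner (x i) (x j)"
    using assms(2) by (simp add: tight2_def cinner_scaleC_left)
  finally have g: "(\<Sum>k\<in>I. cinner (x i) (x k) * cinner (x k) (x j)) = 2 * cinner (x i) (x j)" .
  have "(\<Sum>k\<in>I. offgram x i k * offgram x k j) =
      (\<Sum>k\<in>I. cinner (x i) (x k) * cinner (x k) (x j) - d i k * cinner (x k) (x j)
          - cinner (x i) (x k) * d k j + d i k * d k j)"
    by (rule sum.cong) (auto simp: u assms algebra_simps)
  also have "\<dots> = 2 * cinner (x i) (x j) - cinner (x i) (x j) - cinner (x i) (x j) + d i j"
    by (simp only: sum.distrib sum_subtractf g dl[OF assms(3)] dr[OF assms(4)])
  finally show ?thesis by (simp add: d_def)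
qed

lemma offgram_row:
  assumes "finite I" "x \<in> tight2 I" "i \<in> I"
  shows "(\<Sum>k\<in>I. (cmod (offgram x i k))\<^sup>2) = 1"
proof -
  have "complex_of_real (\<Sum>k\<in>I. (cmod (offgram x i k))\<^sup>2) = (\<Sum>k\<in>I. offgram x i k * offgram x k i)"
    unfolding of_real_sum
    by (rule sum.cong[OF refl], subst (3) offgram_commute) (simp only: complex_norm_square)
  also have "\<dots> = complex_of_real 1"
    using offgram_square[OF assms(1,2,3,3)] by simp
  finally show ?thesis by (simp only: of_real_eq_iff)
qed

section \<open>Phase changes\<close>

definition rephase :: "'i set \<Rightarrow> ('i \<Rightarrow> complex) \<Rightarrow> ('i \<Rightarrow> 'a::complex_inner) \<Rightarrow> 'i \<Rightarrow> 'a" where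
  "rephase I \<omega> x = (\<lambda>j\<in>I. \<omega> j *\<^sub>C x j)"

lemma rephase_tight2:
  assumes x: "x \<in> tight2 I" and \<omega>: "\<And>j. j \<in> I \<Longrightarrow> cmod (\<omega> j) = 1"
  shows "rephase I \<omega> x \<in> tight2 I"
proof -
  have "(\<Sum>j\<in>I. cinner y (\<omega> j *\<^sub>C x j) *\<^sub>C \<omega> j *\<^sub>C x j) = (\<Sum>j\<in>I. cinner y (x j) *\<^sub>C x j)" for y
  proof (rule sum.cong[OF refl])
    fix j assume "j \<in> I"
    then have "cnj (\<omega> j) * \<omega> j = 1"
      using \<omega> complex_norm_square[of "\<omega> j"] by (simp add: mult.commute)
    moreover have "cnj (\<omega> j) * cinner y (x j) * \<omega> j = (cnj (\<omega> j) * \<omega> j) * cinner y (x j)"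
      by (simp only: ac_simps)
    ultimately have "cnj (\<omega> j) * cinner y (x j) * \<omega> j = cinner y (x j)"
      by simp
    then show "cinner y (\<omega> j *\<^sub>C x j) *\<^sub>C \<omega> j *\<^sub>C x j = cinner y (x j) *\<^sub>C x j"
      by (simp add: cinner_scaleC_right scaleC_scaleC)
  qed
  with x \<omega> show ?thesis
    by (auto simp: tight2_def rephase_def norm_scaleC)
qed

lemma linked_rephase:
  fixes x :: "'i \<Rightarrow> 'a::complex_inner"
  assumes x: "x \<in> tight2 I" and \<omega>: "\<And>j. j \<in> I \<Longrightarrow> cmod (\<omega> j) = 1"
  shows "linked I x (rephase I \<omega> x)"
proof -
  define \<gamma> where "\<gamma> t = rephase I (\<lambda>j. cis (t * Arg (\<omega> j))) x" for t
  have "\<gamma> 0 = x"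
    using x by (auto simp: \<gamma>_def rephase_def scaleC_one tight2_def extensional_def fun_eq_iff)
  moreover have "\<gamma> 1 = rephase I \<omega> x"
    using \<omega> by (auto simp: \<gamma>_def rephase_def fun_eq_iff cis_Arg restrict_def sgn_eq)
       (metis cis_Arg div_by_1 norm_zero of_real_1 sgn_eq zero_neq_one)
  moreover have "linked I (\<gamma> 0) (\<gamma> 1)"
  proof (rule linked_path)
    show "\<gamma> t \<in> tight2 I" for t
      unfolding \<gamma>_def by (rule rephase_tight2) (use x in auto)
    show "continuous_on UNIV (\<lambda>t. \<gamma> t j)" if "j \<in> I" for j
      using that by (auto simp: \<gamma>_def rephase_def intro!: scaleC.continuous_on continuous_intros)
  qed
  ultimately show ?thesis by simp
qed

lemma offgram_rephase:
  assumes "i \<in> I" "j \<in> I"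
  shows "offgram (rephase I \<omega> x) i j = \<omega> i * cnj (\<omega> j) * offgram x i j"
  using assms by (simp add: offgram_def rephase_def cinner_scaleC_left cinner_scaleC_right)

section \<open>Rotations of pairs\<close>

definition rot :: "'i \<Rightarrow> 'i \<Rightarrow> real \<Rightarrow> real \<Rightarrow> complex \<Rightarrow> ('i \<Rightarrow> 'a::complex_inner) \<Rightarrow> 'i \<Rightarrow> 'a" where
  "rot i j c s w x = x(i := complex_of_real c *\<^sub>C x i + (w * s) *\<^sub>C x j,
                       j := complex_of_real c *\<^sub>C x j + (- cnj w * s) *\<^sub>C x i)"

text \<open>Up to sign and the factor 2 c s, the real part is the cross term in the squared norms of
  both rotated vectors, so its vanishing keeps them of length 1.\<close>

definition rotatable :: "('i \<Rightarrow> 'a::complex_inner) \<Rightarrow> 'i \<Rightarrow> 'i \<Rightarrow> complex \<Rightarrow> bool" where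
  "rotatable x i j w \<longleftrightarrow> cmod w = 1 \<and> Re (cnj w * cinner (x i) (x j)) = 0"

text \<open>The coefficient matrix of the rotation is unitary, so the two new vectors contribute to
  the frame operator what the old ones did; rotatability preserves their norms.\<close>

lemma rot_tight2:
  fixes x :: "'i \<Rightarrow> 'a::complex_inner"
  assumes "finite I" "x \<in> tight2 I" "i \<in> I" "j \<in> I" "i \<noteq> j"
    and cs: "c\<^sup>2 + s\<^sup>2 = 1" and w: "rotatable x i j w"
  shows "rot i j c s w x \<in> tight2 I"
proof -
  define \<alpha> \<beta> \<delta> where "\<alpha> = complex_of_real c" and "\<beta> = w * s" and "\<delta> = - cnj w * s"
  let ?xi = "\<alpha> *\<^sub>C x i + \<beta> *\<^sub>C x j"
  let ?xj = "\<alpha> *\<^sub>C x j + \<delta> *\<^sub>C x i"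
  have ww: "w * cnj w = 1" "cmod w = 1"
    using w complex_norm_square[of w] by (auto simp: rotatable_def)
  have cs': "complex_of_real c * c + complex_of_real s * s = 1"
    using cs by (simp add: power2_eq_square flip: of_real_mult of_real_add)
  have unitary: "cnj \<alpha> * \<alpha> + cnj \<delta> * \<delta> = 1" "cnj \<beta> * \<beta> + cnj \<alpha> * \<alpha> = 1"
    "cnj \<beta> * \<alpha> + cnj \<alpha> * \<delta> = 0" "cnj \<alpha> * \<beta> + cnj \<delta> * \<alpha> = 0"
  proof -
    have "cnj \<delta> * \<delta> = (w * cnj w) * (complex_of_real s * s)"
      by (simp add: \<delta>_def)
    moreover have "cnj \<beta> * \<beta> = (w * cnj w) * (complex_of_real s * s)"
      by (simp add: \<beta>_def)
    ultimately show "cnj \<alpha> * \<alpha> + cnj \<delta> * \<delta> = 1" "cnj \<beta> * \<beta> + cnj \<alpha> * \<alpha> = 1"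
      using cs' ww(1) by (simp_all add: \<alpha>_def add.commute)
  qed (simp_all add: \<alpha>_def \<beta>_def \<delta>_def)
  have norms: "(cmod \<alpha>)\<^sup>2 = c\<^sup>2" "(cmod \<beta>)\<^sup>2 = s\<^sup>2" "(cmod \<delta>)\<^sup>2 = s\<^sup>2"
    using ww by (simp_all add: \<alpha>_def \<beta>_def \<delta>_def norm_mult)
  have unit: "norm (x i) = 1" "norm (x j) = 1"
    using assms by (auto simp: tight2_def)
  have "w * cinner (x j) (x i) = cnj (cnj w * cinner (x i) (x j))"
    by (subst cinner_commute) simp
  with w have re: "Re (cnj w * cinner (x i) (x j)) = 0" "Re (w * cinner (x j) (x i)) = 0"
    unfolding rotatable_def by (simp_all only: cnj.sel)
  have Re_r: "Re (complex_of_real r * z) = r * Re z" for r z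
    by simp
  have "cinner (\<alpha> *\<^sub>C x i) (\<beta> *\<^sub>C x j) = complex_of_real (c * s) * (cnj w * cinner (x i) (x j))"
    by (simp add: cinner_scaleC_left cinner_scaleC_right \<alpha>_def \<beta>_def)
  then have "Re (cinner (\<alpha> *\<^sub>C x i) (\<beta> *\<^sub>C x j)) = 0"
    using re(1) by (simp only: Re_r mult_zero_right)
  then have ni: "(norm ?xi)\<^sup>2 = 1"
    using cs by (simp add: norm_add_squared norm_scaleC unit norms)
  have "cinner (\<alpha> *\<^sub>C x j) (\<delta> *\<^sub>C x i) = complex_of_real (- c * s) * (w * cinner (x j) (x i))"
    by (simp add: cinner_scaleC_left cinner_scaleC_right \<alpha>_def \<delta>_def cinner.minus_right)
  then have "Re (cinner (\<alpha> *\<^sub>C x j) (\<delta> *\<^sub>C x i)) = 0"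
    using re(2) by (simp only: Re_r mult_zero_right)
  then have nj: "(norm ?xj)\<^sup>2 = 1"
    using cs by (simp add: norm_add_squared norm_scaleC unit norms)
  \<comment> \<open>Collecting the coefficients of x_i and x_j on the left leaves exactly the four
    expressions evaluated in \<open>unitary\<close>.\<close>
  have pair: "cinner y ?xi *\<^sub>C ?xi + cinner y ?xj *\<^sub>C ?xj = cinner y (x i) *\<^sub>C x i + cinner y (x j) *\<^sub>C x j" for y
  proof -
    let ?p = "cinner y (x i)" and ?q = "cinner y (x j)"
    have yi: "cinner y ?xi = cnj \<alpha> * ?p + cnj \<beta> * ?q"
      and yj: "cinner y ?xj = cnj \<alpha> * ?q + cnj \<delta> * ?p"
      by (simp_all only: cinner_add_right cinner_scaleC_right)
    have "A *\<^sub>C ?xi + B *\<^sub>C ?xj = (A * \<alpha> + B * \<delta>) *\<^sub>C x i + (A * \<beta> + B * \<alpha>) *\<^sub>C x j" for A B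
      by (simp only: scaleC_add_right scaleC_add_left scaleC_scaleC ac_simps)
    moreover have "cinner y ?xi * \<alpha> + cinner y ?xj * \<delta> =
        (cnj \<alpha> * \<alpha> + cnj \<delta> * \<delta>) * ?p + (cnj \<beta> * \<alpha> + cnj \<alpha> * \<delta>) * ?q"
      unfolding yi yj by (simp only: distrib_left distrib_right ac_simps)
    moreover have "cinner y ?xi * \<beta> + cinner y ?xj * \<alpha> =
        (cnj \<alpha> * \<beta> + cnj \<delta> * \<alpha>) * ?p + (cnj \<beta> * \<beta> + cnj \<alpha> * \<alpha>) * ?q"
      unfolding yi yj by (simp only: distrib_left distrib_right ac_simps)
    ultimately show ?thesis
      by (simp only: unitary mult_1 mult_zero_left add_0_left add_0_right)
  qed
  have rot: "rot i j c s w x = x(i := ?xi, j := ?xj)"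
    by (simp add: rot_def \<alpha>_def \<beta>_def \<delta>_def)
  have "(\<Sum>k\<in>I. cinner y (rot i j c s w x k) *\<^sub>C rot i j c s w x k) = (\<Sum>k\<in>I. cinner y (x k) *\<^sub>C x k)" for y
  proof -
    have split: "(\<Sum>k\<in>I. f k) = (f i + f j) + (\<Sum>k\<in>I - {i,j}. f k)" for f :: "'i \<Rightarrow> 'a"
      using assms by (subst sum.subset_diff[of "{i,j}"]) (auto simp: add.commute)
    show ?thesis
      unfolding split rot using pair[of y] assms(5) by simp
  qed
  moreover have "norm (rot i j c s w x k) = 1" if "k \<in> I" for k
    using that assms(2) ni nj norm_ge_zero[of ?xi] norm_ge_zero[of ?xj]
    unfolding rot by (auto simp: tight2_def power2_eq_1_iff simp del: norm_ge_zero)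
  moreover have "rot i j c s w x \<in> I \<rightarrow>\<^sub>E UNIV"
    using assms unfolding rot by (auto simp: tight2_def extensional_def PiE_def)
  ultimately show ?thesis
    using assms(2) by (simp add: tight2_def)
qed

lemma linked_rot:
  fixes x :: "'i \<Rightarrow> 'a::complex_inner"
  assumes "finite I" "x \<in> tight2 I" "i \<in> I" "j \<in> I" "i \<noteq> j"
    and cs: "c\<^sup>2 + s\<^sup>2 = 1" and w: "rotatable x i j w"
  shows "linked I x (rot i j c s w x)"
proof -
  obtain t where t: "c = cos t" "s = sin t"
    using sincos_total_2pi[OF cs] by metis
  define \<gamma> where "\<gamma> t = rot i j (cos t) (sin t) w x" for t
  have "linked I (\<gamma> 0) (\<gamma> t)"
  proof (rule linked_path)
    show "\<gamma> t \<in> tight2 I" for t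
      unfolding \<gamma>_def by (rule rot_tight2) (use assms in auto)
    show "continuous_on UNIV (\<lambda>t. \<gamma> t k)" for k
      by (cases "k = j"; cases "k = i")
         (auto simp: \<gamma>_def rot_def intro!: scaleC.continuous_on continuous_intros)
  qed
  moreover have "\<gamma> 0 = x"
    by (auto simp: \<gamma>_def rot_def scaleC_one)
  ultimately show ?thesis
    by (simp add: \<gamma>_def t)
qed

lemma offgram_rot:
  assumes "k \<noteq> i" "k \<noteq> j" "i \<noteq> j"
  shows "offgram (rot i j c s w x) i k = c * offgram x i k + w * s * offgram x j k"
proof -
  have "i \<noteq> k" "j \<noteq> k"
    using assms by auto
  with assms show ?thesis
    by (simp add: offgram_def rot_def cinner_add_left cinner_scaleC_left)
qed

lemma offgram_rot_other:
  assumes "k \<noteq> i" "k \<noteq> j" "l \<noteq> i" "l \<noteq> j"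
  shows "offgram (rot i j c s w x) k l = offgram x k l"
  using assms by (simp add: offgram_def rot_def)

text \<open>The phase is i times that of <x_i, x_j>; for orthogonal vectors every phase is
  admissible and 1 is taken. The second property recovers the inner product from \<open>w\<close>,
  turning conditions on \<open>w\<close> into conditions on Gram entries.\<close>

lemma exists_rotatable:
  obtains w where "rotatable x i j w"
    "cinner (x i) (x j) = - \<i> * cmod (cinner (x i) (x j)) * w"
proof (cases "cinner (x i) (x j) = 0")
  case True
  with that[of 1] show ?thesis by (simp add: rotatable_def)
next
  case False
  let ?w = "\<i> * sgn (cinner (x i) (x j))"
  have "cnj (sgn (cinner (x i) (x j))) * cinner (x i) (x j) = cmod (cinner (x i) (x j))"
    by (rule cnj_sgn_mult)
  then have "cnj ?w * cinner (x i) (x j) = - (\<i> * cmod (cinner (x i) (x j)))"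
    by (simp add: mult.assoc)
  moreover have "cinner (x i) (x j) = - \<i> * cmod (cinner (x i) (x j)) * ?w"
    using False by (simp add: sgn_eq)
  ultimately show ?thesis
    using False by (intro that[of ?w]) (simp_all add: rotatable_def norm_mult norm_sgn)
qed

section \<open>Maximisers of an off-diagonal Gram entry\<close>

text \<open>The second claim is the first-order condition at (c, s) = (1, 0): the squared modulus
  has derivative 2 Re (A cnj B) there along the circle. The proof replaces the derivative by one
  well-chosen point.\<close>

lemma circle_maximum:
  fixes A B :: complex
  assumes max: "\<And>c s. c\<^sup>2 + s\<^sup>2 = (1::real) \<Longrightarrow> cmod (c * A + s * B) \<le> cmod A"
  shows "cmod B \<le> cmod A" and "Re (A * cnj B) = 0"
proof -
  define r where "r = Re (A * cnj B)"
  define D where "D = (cmod A)\<^sup>2 - (cmod B)\<^sup>2"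
  show BA: "cmod B \<le> cmod A"
    using max[of 0 1] by simp
  then have D: "0 \<le> D"
    by (simp add: D_def power_mono)
  have *: "2 * c * s * r \<le> s\<^sup>2 * D" if cs: "c\<^sup>2 + s\<^sup>2 = 1" for c s :: real
  proof -
    have "(cmod (c * A + s * B))\<^sup>2 = c\<^sup>2 * (cmod A)\<^sup>2 + s\<^sup>2 * (cmod B)\<^sup>2 + 2 * c * s * r"
      unfolding cmod_power2 r_def by (simp add: power2_eq_square algebra_simps)
    moreover have "(cmod (c * A + s * B))\<^sup>2 \<le> (c\<^sup>2 + s\<^sup>2) * (cmod A)\<^sup>2"
      using max[OF cs] cs by (simp add: power_mono)
    ultimately show ?thesis
      by (simp add: D_def algebra_simps)
  qed
  show "Re (A * cnj B) = 0"
  proof (rule ccontr)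
    assume "Re (A * cnj B) \<noteq> 0"
    then have "r \<noteq> 0" by (simp add: r_def)
    \<comment> \<open>At the point of the circle in direction (D + 1, r), inequality
      \<open>*\<close> amounts to 2 (D + 1) r^2 <= D r^2, which is impossible for D >= 0 and r
      nonzero.\<close>
    define N where "N = sqrt ((D + 1)\<^sup>2 + r\<^sup>2)"
    have N: "N\<^sup>2 = (D + 1)\<^sup>2 + r\<^sup>2" "N \<noteq> 0"
      using \<open>r \<noteq> 0\<close> by (auto simp: N_def add_nonneg_eq_0_iff)
    have "((D + 1) / N)\<^sup>2 + (r / N)\<^sup>2 = 1"
      using N \<open>r \<noteq> 0\<close> by (simp add: power_divide flip: add_divide_distrib)
    from *[OF this] have "2 * (D + 1) * r\<^sup>2 / N\<^sup>2 \<le> r\<^sup>2 * D / N\<^sup>2"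
      by (simp add: power2_eq_square power_divide)
    then have "2 * (D + 1) * r\<^sup>2 \<le> r\<^sup>2 * D"
      using N(2) by (simp add: divide_le_cancel)
    then have "r\<^sup>2 * (D + 2) \<le> 0"
      by (simp add: algebra_simps)
    moreover have "0 < r\<^sup>2 * (D + 2)"
      using D \<open>r \<noteq> 0\<close> by simp
    ultimately show False by simp
  qed
qed

text \<open>\<open>M\<close> abstracts the set of maximisers of |u_ba| in one component,
  \<open>J\<close> the indices not yet split off into parallel pairs. Moves that fix the vectors a
  and b stay in \<open>M\<close>; for rotations of b with a further index only the bound by
  \<open>m\<close> is available.\<close>

locale maximal_pair =
  fixes I J :: "'i set" and a b :: 'i and M :: "('i \<Rightarrow> 'a::complex_inner) set" and m :: real
  assumes fin: "finite I" and J: "J \<subseteq> I" and ab: "a \<in> J" "b \<in> J" "a \<noteq> b"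
    and M: "M \<subseteq> tight2 I"
    and decoupled: "\<And>z j k. z \<in> M \<Longrightarrow> j \<in> J \<Longrightarrow> k \<in> I - J \<Longrightarrow> offgram z j k = 0"
    and val: "\<And>z. z \<in> M \<Longrightarrow> cmod (offgram z b a) = m"
    and rephase_closed: "\<And>z \<omega>. z \<in> M \<Longrightarrow> (\<And>j. j \<in> I \<Longrightarrow> cmod (\<omega> j) = 1) \<Longrightarrow> rephase I \<omega> z \<in> M"
    and rot_closed: "\<And>z i j (c::real) s w. z \<in> M \<Longrightarrow> i \<in> J - {a,b} \<Longrightarrow> j \<in> J - {a,b} \<Longrightarrow> i \<noteq> j \<Longrightarrow>
      c\<^sup>2 + s\<^sup>2 = 1 \<Longrightarrow> rotatable z i j w \<Longrightarrow> rot i j c s w z \<in> M"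
    and maximal: "\<And>z j (c::real) s w. z \<in> M \<Longrightarrow> j \<in> J - {a,b} \<Longrightarrow>
      c\<^sup>2 + s\<^sup>2 = 1 \<Longrightarrow> rotatable z b j w \<Longrightarrow> cmod (offgram (rot b j c s w z) b a) \<le> m"
begin

text \<open>Rotating b with j changes u_ba into c u_ba + s w u_ja, so \<open>circle_maximum\<close>
  yields both claims.\<close>

lemma rotation_bounds:
  assumes "z \<in> M" "j \<in> J - {a,b}" "rotatable z b j w"
  shows "cmod (offgram z j a) \<le> m" "Re (offgram z b a * cnj (w * offgram z j a)) = 0"
proof -
  have *: "cmod (c * offgram z b a + s * (w * offgram z j a)) \<le> cmod (offgram z b a)"
    if "c\<^sup>2 + s\<^sup>2 = 1" for c s :: real
  proof -
    have "a \<noteq> b" "a \<noteq> j" "b \<noteq> j" using assms(2) ab(3) by auto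
    with maximal[OF assms(1,2) that assms(3)] show ?thesis
      by (simp add: offgram_rot val[OF assms(1)] mult_ac)
  qed
  show "Re (offgram z b a * cnj (w * offgram z j a)) = 0"
    by (rule circle_maximum(2)[OF *])
  show "cmod (offgram z j a) \<le> m"
    using circle_maximum(1)[OF *] assms(3) by (simp add: val[OF assms(1)] norm_mult rotatable_def)
qed

text \<open>This is the first-order condition freed from \<open>w\<close>: for the phase given by
  \<open>exists_rotatable\<close>, u_jb is i q cnj w with q real, so the product is i q times a
  number with vanishing real part. Unlike that condition, it is invariant under changes of
  phases.\<close>

lemma triple_product_real:
  assumes "z \<in> M" "j \<in> J - {a,b}"
  shows "Im (offgram z b a * offgram z a j * offgram z j b) = 0"
proof -
  obtain w where w: "rotatable z b j w" "cinner (z b) (z j) = - \<i> * cmod (cinner (z b) (z j)) * w"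
    by (rule exists_rotatable)
  define q where "q = cmod (cinner (z b) (z j))"
  have "offgram z j b = cnj (offgram z b j)"
    by (rule offgram_commute)
  also have "offgram z b j = - \<i> * q * w"
    using w(2) assms(2) by (auto simp: offgram_def q_def)
  finally have jb: "offgram z j b = \<i> * q * cnj w"
    by simp
  have aj: "offgram z a j = cnj (offgram z j a)"
    by (rule offgram_commute)
  have "offgram z b a * offgram z a j * offgram z j b = \<i> * q * (offgram z b a * cnj (w * offgram z j a))"
    unfolding jb aj by (simp add: mult_ac)
  also have "Im \<dots> = q * Re (offgram z b a * cnj (w * offgram z j a))"
    by (simp add: algebra_simps)
  finally show ?thesis
    using rotation_bounds(2)[OF assms w(1)] by simp
qed

lemma sum_split:
  assumes "\<And>k. k \<in> I - J \<Longrightarrow> f k = 0"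
  shows "sum f I = f a + f b + sum f (J - {a,b})"
proof -
  have "finite J" using J fin finite_subset by blast
  then have "sum f J = sum f (J - {a,b}) + sum f {a,b}"
    using ab by (intro sum.subset_diff) auto
  moreover have "sum f I = sum f J"
    using assms J fin by (intro sum.mono_neutral_right) auto
  ultimately show ?thesis
    using ab(3) by (simp add: ac_simps)
qed

lemma row_sum:
  assumes "z \<in> M" "i \<in> {a,b}" "j \<in> J"
  shows "offgram z i a * offgram z a j + offgram z i b * offgram z b j +
    (\<Sum>k\<in>J - {a,b}. offgram z i k * offgram z k j) = (if i = j then 1 else 0)"
proof -
  have "(\<Sum>k\<in>I. offgram z i k * offgram z k j) = (if i = j then 1 else 0)"
    using assms M J ab by (intro offgram_square fin) auto
  moreover have "offgram z i k * offgram z k j = 0" if "k \<in> I - J" for k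
    using decoupled[OF assms(1) _ that] assms(2) ab by auto
  ultimately show ?thesis
    using sum_split[of "\<lambda>k. offgram z i k * offgram z k j"] by simp
qed

lemma row_norm:
  assumes "z \<in> M"
  shows "m\<^sup>2 + (\<Sum>k\<in>J - {a,b}. (cmod (offgram z a k))\<^sup>2) = 1"
proof -
  have "(\<Sum>k\<in>I. (cmod (offgram z a k))\<^sup>2) = 1"
    using assms M J ab by (intro offgram_row fin) auto
  moreover have "(cmod (offgram z a k))\<^sup>2 = 0" if "k \<in> I - J" for k
    using decoupled[OF assms _ that] ab by simp
  ultimately show ?thesis
    using sum_split[of "\<lambda>k. (cmod (offgram z a k))\<^sup>2"] val[OF assms]
    by (simp add: cmod_offgram_commute[of z a b])
qed

text \<open>If m were 0, \<open>rotation_bounds\<close> would annihilate the whole row a, which has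
  norm 1.\<close>

lemma m_pos:
  assumes z: "z \<in> M"
  shows "0 < m"
proof (rule ccontr)
  assume "\<not> 0 < m"
  then have m: "m = 0"
    using val[OF z] norm_ge_zero[of "offgram z b a"] by linarith
  have "cmod (offgram z a k) = 0" if k: "k \<in> J - {a,b}" for k
  proof -
    obtain w where "rotatable z b k w" by (rule exists_rotatable)
    from rotation_bounds(1)[OF z k this] show ?thesis
      using m cmod_offgram_commute[of z a k] by simp
  qed
  with row_norm[OF z] m show False by simp
qed

section \<open>Real normal form up to phases\<close>

definition normal :: "('i \<Rightarrow> 'a) \<Rightarrow> bool" where
  "normal z \<longleftrightarrow> z \<in> M \<and> offgram z b a = m \<and>
     (\<forall>j\<in>J - {a,b}. Im (offgram z a j) = 0 \<and> Im (offgram z b j) = 0)"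

text \<open>Since m > 0, u_ba has a phase that \<open>wb\<close> can cancel. Vector j receives the
  phase that makes u_aj positive, and reality of the triple product then makes u_bj real as well.
  Where u_aj = 0, the phase is spent on u_bj instead.\<close>

lemma normalize:
  assumes z: "z \<in> M"
  obtains \<omega> where "\<And>j. j \<in> I \<Longrightarrow> cmod (\<omega> j) = 1" "normal (rephase I \<omega> z)"
proof -
  define wb where "wb = cnj (sgn (offgram z b a))"
  define \<omega> where "\<omega> j =
    (if j = a then 1 else if j = b then wb
     else if offgram z a j \<noteq> 0 then sgn (offgram z a j)
     else if offgram z b j \<noteq> 0 then wb * sgn (offgram z b j) else 1)" for j
  let ?z = "rephase I \<omega> z"
  have wb: "cmod wb = 1"
    using val[OF z] m_pos[OF z] by (auto simp: wb_def norm_sgn)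
  then have wb': "wb * cnj wb = 1"
    using complex_norm_square[of wb] by simp
  have unit: "cmod (\<omega> j) = 1" for j
    using wb by (auto simp: \<omega>_def norm_sgn norm_mult)
  then have zM: "?z \<in> M"
    by (intro rephase_closed z)
  have aI: "a \<in> I" "b \<in> I" using ab J by auto
  have ba: "offgram ?z b a = m"
    using ab(3) aI val[OF z] by (simp add: offgram_rephase \<omega>_def wb_def cnj_sgn_mult)
  have "Im (offgram ?z a j) = 0 \<and> Im (offgram ?z b j) = 0" if j: "j \<in> J - {a,b}" for j
  proof (cases "offgram z a j = 0")
    case False
    have jI: "j \<in> I" using j J by auto
    have aj: "offgram ?z a j = cmod (offgram z a j)"
      using False j aI jI by (simp add: offgram_rephase \<omega>_def cnj_sgn_mult)
    have "m * cmod (offgram z a j) * Im (offgram ?z j b) = 0"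
      using triple_product_real[OF zM j] unfolding ba aj by (simp add: mult.assoc)
    then have "Im (offgram ?z j b) = 0"
      using False m_pos[OF z] by simp
    then show ?thesis
      using aj offgram_commute[of ?z b j] by simp
  next
    case True
    have jI: "j \<in> I" using j J by auto
    show ?thesis
    proof (cases "offgram z b j = 0")
      case True
      then show ?thesis
        using \<open>offgram z a j = 0\<close> aI jI by (simp add: offgram_rephase)
    next
      case False
      have "offgram ?z b j = (wb * cnj wb) * (cnj (sgn (offgram z b j)) * offgram z b j)"
        using False True j aI jI ab(3) by (simp add: offgram_rephase \<omega>_def mult_ac)
      then have "offgram ?z b j = cmod (offgram z b j)"
        by (simp only: wb' cnj_sgn_mult mult_1)
      then show ?thesis
        using True aI jI by (simp add: offgram_rephase)
    qed
  qed
  with zM ba have "normal ?z" by (simp add: normal_def)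
  with unit that show ?thesis by blast
qed

lemma normal_row:
  assumes "normal z" "j \<in> J - {a,b}"
  shows "offgram z a j = Re (offgram z a j)" "offgram z b j = Re (offgram z b j)"
    "offgram z j a = Re (offgram z a j)" "offgram z j b = Re (offgram z b j)"
  using assms offgram_commute[of z j a] offgram_commute[of z j b]
  by (auto simp: normal_def complex_eq_iff)

section \<open>Rotating a normal form by 45 degrees\<close>

lemma rotated_rows:
  fixes w :: complex
  assumes z: "normal z" and ij: "i \<in> J - {a,b}" "j \<in> J - {a,b}" "i \<noteq> j" and w: "rotatable z i j w"
  defines "z' \<equiv> rot i j (sqrt (1/2)) (sqrt (1/2)) w z"
  shows "z' \<in> M" "offgram z' b a = m"
    "offgram z' i a = sqrt (1/2) * (Re (offgram z a i) + w * Re (offgram z a j))"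
    "offgram z' i b = sqrt (1/2) * (Re (offgram z b i) + w * Re (offgram z b j))"
proof -
  show "z' \<in> M"
    unfolding z'_def using z w by (intro rot_closed ij) (auto simp: normal_def)
  have ne: "a \<noteq> i" "a \<noteq> j" "b \<noteq> i" "b \<noteq> j"
    using ij by auto
  show "offgram z' b a = m"
    unfolding z'_def using z ne by (simp add: offgram_rot_other normal_def)
  show "offgram z' i a = sqrt (1/2) * (Re (offgram z a i) + w * Re (offgram z a j))"
    unfolding z'_def offgram_rot[OF ne(1,2) ij(3)]
    by (subst (1 2) normal_row(3)[OF z]) (use ij in \<open>auto simp: algebra_simps\<close>)
  show "offgram z' i b = sqrt (1/2) * (Re (offgram z b i) + w * Re (offgram z b j))"
    unfolding z'_def offgram_rot[OF ne(3,4) ij(3)]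
    by (subst (1 2) normal_row(4)[OF z]) (use ij in \<open>auto simp: algebra_simps\<close>)
qed

text \<open>The rotated frame is again in \<open>M\<close>, so its triple product at i is real. The
  imaginary part of that product is m / 2 times Im w times a 2 by 2 determinant of the real rows a
  and b.\<close>

lemma rotation_parallel:
  assumes z: "normal z" and ij: "i \<in> J - {a,b}" "j \<in> J - {a,b}" "i \<noteq> j" and w: "rotatable z i j w"
  shows "Im w * (Re (offgram z a j) * Re (offgram z b i) - Re (offgram z a i) * Re (offgram z b j)) = 0"
proof -
  let ?z = "rot i j (sqrt (1/2)) (sqrt (1/2)) w z"
  let ?ai = "Re (offgram z a i)" and ?aj = "Re (offgram z a j)"
    and ?bi = "Re (offgram z b i)" and ?bj = "Re (offgram z b j)"
  define h where "h = sqrt (1/2)"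
  note r = rotated_rows[OF z ij w, folded h_def]
  have "offgram ?z a i = h * (?ai + cnj w * ?aj)"
    using r(3) offgram_commute[of ?z a i] by (simp add: h_def)
  then have "Im (m * (h * (?ai + cnj w * ?aj)) * (h * (?bi + w * ?bj))) = 0"
    using triple_product_real[OF r(1) ij(1)] r(2,4) by (simp only: h_def)
  moreover have "Im (m * (h * (?ai + cnj w * ?aj)) * (h * (?bi + w * ?bj))) =
      (m * (h * h)) * (Im w * (?ai * ?bj - ?aj * ?bi))"
    by (simp add: algebra_simps)
  moreover have "m * (h * h) \<noteq> 0"
    using m_pos z by (auto simp: h_def normal_def)
  ultimately show ?thesis
    by (auto simp: algebra_simps)
qed

text \<open>For the phase from \<open>exists_rotatable\<close>, Re u_ij is a real multiple of Im
  w.\<close>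

lemma parallel_or_imaginary:
  assumes z: "normal z" and ij: "i \<in> J - {a,b}" "j \<in> J - {a,b}"
  shows "Re (offgram z i j) * (Re (offgram z a j) * Re (offgram z b i) - Re (offgram z a i) * Re (offgram z b j)) = 0"
proof (cases "i = j")
  case False
  obtain w where w: "rotatable z i j w" "cinner (z i) (z j) = - \<i> * cmod (cinner (z i) (z j)) * w"
    by (rule exists_rotatable)
  define q where "q = cmod (cinner (z i) (z j))"
  have "offgram z i j = - \<i> * q * w"
    using w(2) False by (simp add: offgram_def q_def)
  then have "Re (offgram z i j) = q * Im w"
    by simp
  with rotation_parallel[OF z ij False w(1)] show ?thesis
    by (auto simp only: mult.assoc mult_zero_right)
qed simp

text \<open>Write \<alpha>, \<beta> for the real rows a, b and R_k = Re u_kj. The entries (a, j) and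
  (b, j) of u^2 = 1 give m \<beta>_j = - sum \<alpha>_k R_k and m \<alpha>_j = - sum \<beta>_k R_k.
  Multiplied by \<beta>_j and \<alpha>_j respectively, the two sums agree term by term, by
  \<open>parallel_or_imaginary\<close>.\<close>

lemma normal_rows_eq_squares:
  assumes z: "normal z" and j: "j \<in> J - {a,b}"
  shows "(Re (offgram z a j))\<^sup>2 = (Re (offgram z b j))\<^sup>2"
proof -
  let ?\<alpha> = "\<lambda>k. Re (offgram z a k)" and ?\<beta> = "\<lambda>k. Re (offgram z b k)" and ?R = "\<lambda>k. Re (offgram z k j)"
  have zM: "z \<in> M" and ba: "offgram z b a = m" and jJ: "j \<in> J" and ne: "a \<noteq> j" "b \<noteq> j"
    using z j by (auto simp: normal_def)
  have ab': "offgram z a b = m"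
    using ba offgram_commute[of z a b] by simp
  have "m * ?\<beta> j + (\<Sum>k\<in>J - {a,b}. Re (offgram z a k * offgram z k j)) = 0"
    using arg_cong[OF row_sum[OF zM, of a j], of Re] jJ ne ab' by simp
  moreover have "(\<Sum>k\<in>J - {a,b}. Re (offgram z a k * offgram z k j)) = (\<Sum>k\<in>J - {a,b}. ?\<alpha> k * ?R k)"
    by (rule sum.cong[OF refl], subst normal_row(1)[OF z]) simp_all
  ultimately have 1: "m * ?\<beta> j + (\<Sum>k\<in>J - {a,b}. ?\<alpha> k * ?R k) = 0"
    by (simp only:)
  have "m * ?\<alpha> j + (\<Sum>k\<in>J - {a,b}. Re (offgram z b k * offgram z k j)) = 0"
    using arg_cong[OF row_sum[OF zM, of b j], of Re] jJ ne ba by simp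
  moreover have "(\<Sum>k\<in>J - {a,b}. Re (offgram z b k * offgram z k j)) = (\<Sum>k\<in>J - {a,b}. ?\<beta> k * ?R k)"
    by (rule sum.cong[OF refl], subst normal_row(2)[OF z]) simp_all
  ultimately have 2: "m * ?\<alpha> j + (\<Sum>k\<in>J - {a,b}. ?\<beta> k * ?R k) = 0"
    by (simp only:)
  have "?\<beta> j * (\<Sum>k\<in>J - {a,b}. ?\<alpha> k * ?R k) = ?\<alpha> j * (\<Sum>k\<in>J - {a,b}. ?\<beta> k * ?R k)"
    unfolding sum_distrib_left
  proof (rule sum.cong[OF refl])
    fix k assume "k \<in> J - {a,b}"
    from parallel_or_imaginary[OF z this j]
    show "?\<beta> j * (?\<alpha> k * ?R k) = ?\<alpha> j * (?\<beta> k * ?R k)"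
      by (auto simp: algebra_simps)
  qed
  moreover have "(\<Sum>k\<in>J - {a,b}. ?\<alpha> k * ?R k) = - (m * ?\<beta> j)" "(\<Sum>k\<in>J - {a,b}. ?\<beta> k * ?R k) = - (m * ?\<alpha> j)"
    using 1 2 by simp_all
  ultimately have "m * (?\<beta> j * ?\<beta> j) = m * (?\<alpha> j * ?\<alpha> j)"
    by (simp add: algebra_simps)
  then show ?thesis
    using m_pos[OF zM] by (simp add: power2_eq_square)
qed

text \<open>Moduli do not see phases, so the equality extends from normal forms to all of
  \<open>M\<close>; it is later applied to a rotated frame, which need not be normal.\<close>

lemma rows_eq_cmod:
  assumes z: "z \<in> M" and j: "j \<in> J - {a,b}"
  shows "cmod (offgram z j a) = cmod (offgram z j b)"
proof -
  obtain \<omega> where \<omega>: "\<And>j. j \<in> I \<Longrightarrow> cmod (\<omega> j) = 1" "normal (rephase I \<omega> z)"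
    using normalize[OF z] by blast
  have I: "a \<in> I" "b \<in> I" "j \<in> I"
    using ab J j by auto
  have "\<bar>Re (offgram (rephase I \<omega> z) a j)\<bar> = \<bar>Re (offgram (rephase I \<omega> z) b j)\<bar>"
    using normal_rows_eq_squares[OF \<omega>(2) j] by (simp add: power2_eq_iff abs_eq_iff)
  then have "cmod (offgram (rephase I \<omega> z) j a) = cmod (offgram (rephase I \<omega> z) j b)"
    using normal_row(3,4)[OF \<omega>(2) j] by (metis norm_of_real)
  then show ?thesis
    using I \<omega>(1) by (simp add: offgram_rephase norm_mult)
qed

theorem maximum_eq_1:
  assumes "M \<noteq> {}"
  shows "m = 1"
proof (rule ccontr)
  assume "m \<noteq> 1"
  obtain z where z: "normal z"
    using assms normalize by blast
  then have zM: "z \<in> M" by (simp add: normal_def)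
  let ?\<alpha> = "\<lambda>k. Re (offgram z a k)" and ?\<beta> = "\<lambda>k. Re (offgram z b k)"
  let ?J = "J - {a,b}"
  have "(\<Sum>k\<in>?J. (cmod (offgram z a k))\<^sup>2) = (\<Sum>k\<in>?J. (?\<alpha> k)\<^sup>2)"
    by (rule sum.cong[OF refl], subst normal_row(1)[OF z]) simp_all
  then have S: "m\<^sup>2 + (\<Sum>k\<in>?J. (?\<alpha> k)\<^sup>2) = 1"
    using row_norm[OF zM] by (simp only:)
  moreover have "m\<^sup>2 \<noteq> 1"
    using m_pos[OF zM] \<open>m \<noteq> 1\<close> by (auto simp: power2_eq_1_iff)
  moreover have "0 \<le> (\<Sum>k\<in>?J. (?\<alpha> k)\<^sup>2)"
    by (intro sum_nonneg) simp
  ultimately have pos: "0 < (\<Sum>k\<in>?J. (?\<alpha> k)\<^sup>2)"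
    by linarith
  have "(\<Sum>k\<in>?J. Re (offgram z a k * offgram z k b)) = 0"
    using arg_cong[OF row_sum[OF zM, of a b], of Re] ab by simp
  moreover have "(\<Sum>k\<in>?J. Re (offgram z a k * offgram z k b)) = (\<Sum>k\<in>?J. ?\<alpha> k * ?\<beta> k)"
    by (rule sum.cong[OF refl], subst normal_row(1)[OF z], assumption, subst normal_row(4)[OF z]) simp_all
  ultimately have orth: "(\<Sum>k\<in>?J. ?\<alpha> k * ?\<beta> k) = 0"
    by (simp only:)
  \<comment> \<open>As the rows are orthogonal, both sums equal the positive sum of squares. A
    nonzero term of the first excludes \<beta>_i = - \<alpha>_i, one of the second excludes
    \<beta>_j = \<alpha>_j.\<close>
  have "(\<Sum>k\<in>?J. ?\<alpha> k * (?\<alpha> k + ?\<beta> k)) \<noteq> 0" "(\<Sum>k\<in>?J. ?\<alpha> k * (?\<alpha> k - ?\<beta> k)) \<noteq> 0"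
    using pos orth by (simp_all add: distrib_left right_diff_distrib sum.distrib sum_subtractf power2_eq_square)
  then obtain i j where ij: "i \<in> ?J" "?\<alpha> i * (?\<alpha> i + ?\<beta> i) \<noteq> 0" "j \<in> ?J" "?\<alpha> j * (?\<alpha> j - ?\<beta> j) \<noteq> 0"
    by (metis (no_types, lifting) sum.neutral)
  have \<beta>: "?\<beta> i = ?\<alpha> i" "?\<beta> j = - ?\<alpha> j"
    using ij normal_rows_eq_squares[OF z ij(1)] normal_rows_eq_squares[OF z ij(3)]
    by (auto simp: power2_eq_iff)
  have "i \<noteq> j" and nz: "?\<alpha> i \<noteq> 0" "?\<alpha> j \<noteq> 0"
    using ij \<beta> by auto
  obtain w where w: "rotatable z i j w"
    by (rule exists_rotatable)
  \<comment> \<open>The determinant in \<open>rotation_parallel\<close> is now 2 \<alpha>_i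
    \<alpha>_j, which is nonzero.\<close>
  have "Im w = 0"
    using rotation_parallel[OF z ij(1,3) \<open>i \<noteq> j\<close> w] nz \<beta> by auto
  then have wr: "w = Re w"
    by (simp add: complex_eq_iff)
  have Rw: "Re w \<noteq> 0"
    using w wr by (auto simp: rotatable_def)
  note r = rotated_rows[OF z ij(1,3) \<open>i \<noteq> j\<close> w]
  \<comment> \<open>Equal moduli after the rotation mean |\<alpha>_i + w \<alpha>_j| = |\<alpha>_i -
    w \<alpha>_j|; for real nonzero w this forces \<alpha>_i \<alpha>_j = 0.\<close>
  have "sqrt (1/2) * cmod (?\<alpha> i + w * ?\<alpha> j) = sqrt (1/2) * cmod (?\<beta> i + w * ?\<beta> j)"
    using rows_eq_cmod[OF r(1) ij(1)] unfolding r(3,4) by (simp add: norm_mult)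
  then have "cmod (?\<alpha> i + w * ?\<alpha> j) = cmod (?\<alpha> i - w * ?\<alpha> j)"
    by (simp add: \<beta>)
  also have "?\<alpha> i + w * ?\<alpha> j = complex_of_real (?\<alpha> i + Re w * ?\<alpha> j)"
    by (subst wr) simp
  also have "?\<alpha> i - w * ?\<alpha> j = complex_of_real (?\<alpha> i - Re w * ?\<alpha> j)"
    by (subst wr) simp
  finally have "\<bar>?\<alpha> i + Re w * ?\<alpha> j\<bar> = \<bar>?\<alpha> i - Re w * ?\<alpha> j\<bar>"
    by (simp only: norm_of_real)
  then show False
    using nz Rw by (auto simp: abs_eq_iff)
qed

end

section \<open>Continuity of Gram entries and rows with an entry of modulus 1\<close>

lemma continuous_map_cinner:
  assumes "i \<in> I" "j \<in> I"
  shows "continuous_map (tight2_topology I) euclidean (\<lambda>x. cinner (x i) (x j))"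
  by (intro continuous_map_bilinear[OF bounded_bilinear_cinner] continuous_map_component assms)

lemma linked_in_tight2: "linked I x y \<Longrightarrow> x \<in> tight2 I \<and> y \<in> tight2 I"
  by (metis connected_component_in_topspace topspace_tight2)

lemma linked_refl: "x \<in> tight2 I \<Longrightarrow> linked I x x"
  by (simp only: connected_component_of_refl topspace_tight2)

text \<open>The row has norm 1, so an entry of modulus 1 exhausts it.\<close>

lemma offgram_partner:
  assumes "finite I" "x \<in> tight2 I" "i \<in> I" "k \<in> I" "l \<in> I" "l \<noteq> k" "cmod (offgram x i k) = 1"
  shows "offgram x i l = 0"
proof -
  have "(\<Sum>j\<in>{k, l}. (cmod (offgram x i j))\<^sup>2) \<le> (\<Sum>j\<in>I. (cmod (offgram x i j))\<^sup>2)"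
    using assms by (intro sum_mono2) auto
  then show ?thesis
    using assms offgram_row[OF assms(1-3)] by simp
qed

lemma cases_odd_even:
  fixes k n :: nat
  assumes "k \<in> {1..2 * n}"
  obtains q where "q < n" "k = 2 * q + 1 \<or> k = 2 * q + 2"
proof -
  have "(k - 1) div 2 < n" "k = 2 * ((k - 1) div 2) + 1 \<or> k = 2 * ((k - 1) div 2) + 2"
    using assms by auto
  then show ?thesis by (rule that)
qed

section \<open>Linking a frame to a repeated orthonormal basis\<close>

text \<open>Pairs are counted from 0 and vectors from 1, so pair q occupies the indices 2q + 1 and
  2q + 2. For unit vectors, inner product of modulus 1 means parallel.\<close>

definition parallel_pairs :: "nat \<Rightarrow> (nat \<Rightarrow> 'a::complex_inner) \<Rightarrow> bool" where
  "parallel_pairs p x \<longleftrightarrow> (\<forall>q<p. cmod (offgram x (2 * q + 2) (2 * q + 1)) = 1)"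

lemma parallel_pairs_decoupled:
  fixes n :: nat
  assumes "x \<in> tight2 {1..2 * n}" "parallel_pairs p x" "j \<in> {2 * p + 1..2 * n}" "k \<in> {1..2 * p}"
  shows "offgram x j k = 0"
proof -
  obtain q where q: "q < p" "k = 2 * q + 1 \<or> k = 2 * q + 2"
    using cases_odd_even[OF assms(4)] .
  have "cmod (offgram x (2 * q + 2) (2 * q + 1)) = 1" "cmod (offgram x (2 * q + 1) (2 * q + 2)) = 1"
    using assms(2) q(1) cmod_offgram_commute[of x "2 * q + 1" "2 * q + 2"] by (auto simp: parallel_pairs_def)
  then have "offgram x k j = 0"
    using q assms offgram_partner[OF _ assms(1), of "2 * q + 1" "2 * q + 2" j]
      offgram_partner[OF _ assms(1), of "2 * q + 2" "2 * q + 1" j]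
    by auto
  then show ?thesis
    by (subst offgram_commute) simp
qed

lemma parallel_pairs_rephase:
  fixes n :: nat
  assumes "p \<le> n" "\<And>j. j \<in> {1..2 * n} \<Longrightarrow> cmod (\<omega> j) = 1"
  shows "parallel_pairs p (rephase {1..2 * n} \<omega> x) = parallel_pairs p x"
  using assms by (auto simp: parallel_pairs_def offgram_rephase norm_mult)

lemma parallel_pairs_rot:
  assumes "i > 2 * p" "j > 2 * p"
  shows "parallel_pairs p (rot i j c s w x) = parallel_pairs p x"
  using assms by (auto simp: parallel_pairs_def offgram_rot_other)

lemma closedin_parallel_pairs:
  fixes n :: nat
  assumes "p \<le> n"
  shows "closedin (tight2_topology {1..2 * n}) {x \<in> tight2 {1..2 * n}. parallel_pairs p x}"
proof -
  let ?T = "tight2_topology {1..2 * n} :: (nat \<Rightarrow> 'a) topology"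
  let ?S = "\<lambda>q. {x \<in> topspace ?T. cmod (cinner (x (2 * q + 2)) (x (2 * q + 1))) \<in> {1}}"
  have "closedin ?T (?S q)" if "q < p" for q
    by (rule closedin_continuous_map_preimage[where Y = euclidean])
       (use that assms in \<open>auto intro!: continuous_map_norm continuous_map_cinner\<close>)
  then have "closedin ?T (\<Inter>(insert (topspace ?T) (?S ` {..<p})))"
    by (intro closedin_Inter) (use closedin_topspace in blast)+
  moreover have "{x \<in> tight2 {1..2 * n}. parallel_pairs p x} = \<Inter>(insert (topspace ?T) (?S ` {..<p}))"
    unfolding topspace_tight2 by (auto simp: parallel_pairs_def offgram_def)
  ultimately show ?thesis by simp
qed

text \<open>Induction on the number of pairs: among the frames of the component whose first p pairs
  are parallel, a closed set, the next Gram entry is maximised. The finished pairs are orthogonal to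
  the rest, so \<open>maximal_pair\<close> applies to the remaining indices and gives modulus
  1.\<close>

lemma linked_parallel_pairs:
  fixes x :: "nat \<Rightarrow> 'a::complex_inner"
  assumes x: "x \<in> tight2 {1..2 * n}" and "p \<le> n"
  shows "\<exists>z. linked {1..2 * n} x z \<and> parallel_pairs p z"
  using assms(2)
proof (induction p)
  case 0
  then show ?case
    using linked_refl[OF x] by (auto simp: parallel_pairs_def)
next
  case (Suc p)
  let ?I = "{1..2 * n}" and ?J = "{2 * p + 1..2 * n}" and ?a = "2 * p + 1" and ?b = "2 * p + 2"
  obtain z0 where z0: "linked ?I x z0" "parallel_pairs p z0"
    using Suc by auto
  define C :: "(nat \<Rightarrow> 'a) set" where "C = {x \<in> tight2 ?I. parallel_pairs p x}"
  have pn: "p < n" using Suc by simp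
  have "closedin (tight2_topology ?I) C"
    unfolding C_def using pn by (intro closedin_parallel_pairs) simp
  moreover have "z0 \<in> C"
    using z0 linked_in_tight2 by (auto simp: C_def)
  moreover have "continuous_map (tight2_topology ?I) euclideanreal (\<lambda>x. cmod (cinner (x ?b) (x ?a)))"
    using pn by (intro continuous_map_norm continuous_map_cinner) auto
  ultimately obtain z where z: "z \<in> C" "linked ?I z0 z"
    and max: "\<And>y. y \<in> C \<Longrightarrow> linked ?I z0 y \<Longrightarrow> cmod (cinner (y ?b) (y ?a)) \<le> cmod (cinner (z ?b) (z ?a))"
    by (rule linked_maximizer[OF finite_atLeastAtMost]) blast
  define m where "m = cmod (offgram z ?b ?a)"
  define M where "M = {y \<in> C. linked ?I z0 y \<and> cmod (offgram y ?b ?a) = m}"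
  have le_m: "cmod (offgram y ?b ?a) \<le> m" if "y \<in> C" "linked ?I z0 y" for y
    using max[OF that] by (simp add: m_def offgram_def)
  \<comment> \<open>Both indices exceed 2p, so the finished pairs are untouched.\<close>
  have rot: "rot i j c s w y \<in> C \<and> linked ?I z0 (rot i j c s w y)"
    if "y \<in> M" "i \<in> ?J" "j \<in> ?J" "i \<noteq> j" "c\<^sup>2 + s\<^sup>2 = 1" "rotatable y i j w" for y i j c s w
  proof -
    have y: "y \<in> tight2 ?I" "linked ?I z0 y" "parallel_pairs p y"
      using that(1) by (auto simp: M_def C_def)
    have l: "linked ?I y (rot i j c s w y)"
      using that y by (intro linked_rot) auto
    have "parallel_pairs p (rot i j c s w y)"
      using that(2,3) y(3) by (simp add: parallel_pairs_rot)
    then show ?thesis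
      using linked_in_tight2[OF l] connected_component_of_trans[OF y(2) l] by (simp add: C_def)
  qed
  interpret maximal_pair ?I ?J ?a ?b M m
  proof
    show "?J \<subseteq> ?I" "?a \<in> ?J" "?b \<in> ?J"
      using pn by auto
    show "M \<subseteq> tight2 ?I"
      by (auto simp: M_def C_def)
    show "offgram y j k = 0" if "y \<in> M" "j \<in> ?J" "k \<in> ?I - ?J" for y j k
      using that by (intro parallel_pairs_decoupled[of y n p]) (auto simp: M_def C_def)
    show "cmod (offgram y ?b ?a) = m" if "y \<in> M" for y
      using that by (simp add: M_def)
    show "rephase ?I \<omega> y \<in> M" if y: "y \<in> M" and \<omega>: "\<And>j. j \<in> ?I \<Longrightarrow> cmod (\<omega> j) = 1" for y \<omega>
    proof -
      have l: "linked ?I y (rephase ?I \<omega> y)"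
        using y by (intro linked_rephase \<omega>) (auto simp: M_def C_def)
      have "cmod (offgram (rephase ?I \<omega> y) ?b ?a) = cmod (offgram y ?b ?a)"
        using pn \<omega> by (simp add: offgram_rephase norm_mult)
      moreover have "parallel_pairs p (rephase ?I \<omega> y) = parallel_pairs p y"
        using pn \<omega> by (intro parallel_pairs_rephase) auto
      ultimately show ?thesis
        using y connected_component_of_trans[OF _ l] linked_in_tight2[OF l] by (simp add: M_def C_def)
    qed
    show "rot i j c s w y \<in> M" if "y \<in> M" "i \<in> ?J - {?a, ?b}" "j \<in> ?J - {?a, ?b}" "i \<noteq> j"
      "c\<^sup>2 + s\<^sup>2 = 1" "rotatable y i j w" for y i j c s w
    proof -
      have "offgram (rot i j c s w y) ?b ?a = offgram y ?b ?a"
        using that by (intro offgram_rot_other) auto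
      then show ?thesis
        using rot[of y i j c s w] that by (auto simp: M_def)
    qed
    show "cmod (offgram (rot ?b j c s w y) ?b ?a) \<le> m" if "y \<in> M" "j \<in> ?J - {?a, ?b}"
      "c\<^sup>2 + s\<^sup>2 = 1" "rotatable y ?b j w" for y j c s w
      using that pn rot[of y ?b j c s w] by (intro le_m) auto
  qed simp_all
  have zM: "z \<in> M"
    using z by (simp add: M_def m_def)
  then have "m = 1"
    using maximum_eq_1 by blast
  then have "parallel_pairs (Suc p) z"
    using z(1) by (auto simp: C_def parallel_pairs_def m_def less_Suc_eq)
  then show ?case
    using connected_component_of_trans[OF z0(1) z(2)] by blast
qed

section \<open>Linking repeated orthonormal bases\<close>

definition paired :: "nat \<Rightarrow> (nat \<Rightarrow> 'a) \<Rightarrow> bool" where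
  "paired n x \<longleftrightarrow> (\<forall>q<n. x (2 * q + 2) = x (2 * q + 1))"

lemma unit_vectors_eq:
  fixes u v :: "'a::complex_inner"
  assumes "norm u = 1" "norm v = 1" "cinner u v = 1"
  shows "u = v"
proof -
  have "(norm (u + - v))\<^sup>2 = 0"
    by (subst norm_add_squared) (simp add: assms cinner.minus_right)
  then show ?thesis by simp
qed

lemma linked_paired:
  fixes x :: "nat \<Rightarrow> 'a::complex_inner"
  assumes x: "x \<in> tight2 {1..2 * n}"
  shows "\<exists>z. linked {1..2 * n} x z \<and> paired n z"
proof -
  let ?I = "{1..2 * n}"
  obtain y where y: "linked ?I x y" "parallel_pairs n y"
    using linked_parallel_pairs[OF x order_refl] by blast
  have yt: "y \<in> tight2 ?I" using y linked_in_tight2 by blast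
  \<comment> \<open>Only the second vector of each pair is turned, onto the first; for even k in the
    index set, k - 1 is the partner.\<close>
  define \<omega> where "\<omega> k = (if even k \<and> k \<in> ?I then cnj (sgn (cinner (y k) (y (k - 1)))) else 1)" for k
  have u: "cmod (cinner (y (2 * q + 2)) (y (2 * q + 1))) = 1" if "q < n" for q
    using y(2) that by (simp add: parallel_pairs_def offgram_def)
  have "cmod (\<omega> k) = 1" if k: "k \<in> ?I" for k
  proof -
    obtain q where "q < n" "k = 2 * q + 1 \<or> k = 2 * q + 2"
      using cases_odd_even[OF k] .
    then show ?thesis using u[of q] by (auto simp: \<omega>_def norm_sgn)
  qed
  then have l: "linked ?I y (rephase ?I \<omega> y)"
    by (intro linked_rephase yt)
  let ?z = "rephase ?I \<omega> y"
  have "?z (2 * q + 2) = ?z (2 * q + 1)" if "q < n" for q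
  proof (rule unit_vectors_eq)
    show "norm (?z (2 * q + 2)) = 1" "norm (?z (2 * q + 1)) = 1"
      using l linked_in_tight2[OF l] that by (auto simp: tight2_def)
    show "cinner (?z (2 * q + 2)) (?z (2 * q + 1)) = 1"
      using that u[OF that]
      by (simp add: rephase_def \<omega>_def cinner_scaleC_left cinner_scaleC_right cnj_sgn_mult)
  qed
  then show ?thesis
    using connected_component_of_trans[OF y(1) l] unfolding paired_def by blast
qed

lemma paired_orthogonal:
  fixes n :: nat
  assumes x: "x \<in> tight2 {1..2 * n}" "paired n x" and q: "q < n" "r < n" "q \<noteq> r"
  shows "cinner (x (2 * q + 1)) (x (2 * r + 1)) = 0"
proof -
  have "offgram x (2 * q + 1) (2 * q + 2) = cinner (x (2 * q + 1)) (x (2 * q + 1))"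
    using x(2) q by (simp add: offgram_def paired_def)
  then have "cmod (offgram x (2 * q + 1) (2 * q + 2)) = 1"
    using x(1) q by (simp add: cinner_self tight2_def)
  then have "offgram x (2 * q + 1) (2 * r + 1) = 0"
    using q by (intro offgram_partner[OF _ x(1), of _ "2 * q + 2"]) auto
  then show ?thesis
    using q by (simp add: offgram_def)
qed

lemma closedin_agreeing:
  fixes y :: "nat \<Rightarrow> 'a::complex_inner"
  assumes "p \<le> n"
  shows "closedin (tight2_topology {1..2 * n})
    {x \<in> tight2 {1..2 * n}. paired n x \<and> (\<forall>q<p. x (2 * q + 1) = y (2 * q + 1))}"
proof -
  let ?T = "tight2_topology {1..2 * n} :: (nat \<Rightarrow> 'a) topology"
  let ?S = "\<lambda>q. {x \<in> topspace ?T. x (2 * q + 2) - x (2 * q + 1) \<in> {0}}"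
  let ?S' = "\<lambda>q. {x \<in> topspace ?T. x (2 * q + 1) \<in> {y (2 * q + 1)}}"
  have "closedin ?T (?S q)" if "q < n" for q
    by (rule closedin_continuous_map_preimage[where Y = euclidean])
       (use that in \<open>auto intro!: continuous_map_diff continuous_map_component\<close>)
  moreover have "closedin ?T (?S' q)" if "q < p" for q
    by (rule closedin_continuous_map_preimage[where Y = euclidean])
       (use that assms in \<open>auto intro!: continuous_map_component\<close>)
  ultimately have "closedin ?T (\<Inter>(insert (topspace ?T) (?S ` {..<n} \<union> ?S' ` {..<p})))"
    by (intro closedin_Inter) (use closedin_topspace in blast)+
  moreover have "{x \<in> tight2 {1..2 * n}. paired n x \<and> (\<forall>q<p. x (2 * q + 1) = y (2 * q + 1))} =
      \<Inter>(insert (topspace ?T) (?S ` {..<n} \<union> ?S' ` {..<p}))"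
    unfolding topspace_tight2 by (auto simp: paired_def)
  ultimately show ?thesis by simp
qed

text \<open>On the circle c A + s B attains the norm N of (A, B), at (A, B) / N; if this is at most
  A, then B = 0.\<close>

lemma linear_circle_maximum:
  fixes A B :: real
  assumes "\<And>c s. c\<^sup>2 + s\<^sup>2 = 1 \<Longrightarrow> c * A + s * B \<le> A"
  shows "B = 0"
proof (rule ccontr)
  assume B: "B \<noteq> 0"
  define N where "N = sqrt (A\<^sup>2 + B\<^sup>2)"
  have N: "N\<^sup>2 = A\<^sup>2 + B\<^sup>2" "N > 0"
    using B by (auto simp: N_def sum_power2_gt_zero_iff)
  have "(A / N)\<^sup>2 + (B / N)\<^sup>2 = 1"
    using N B by (simp add: power_divide flip: add_divide_distrib)
  from assms[OF this] have "(A\<^sup>2 + B\<^sup>2) / N \<le> A"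
    by (simp add: power2_eq_square add_divide_distrib)
  then have "N\<^sup>2 / N \<le> A"
    by (simp only: N(1))
  then have "N \<le> A"
    using N(2) by (simp add: power2_eq_square)
  then have "N\<^sup>2 \<le> A\<^sup>2"
    using N(2) by (intro power_mono) auto
  with N(1) B show False by simp
qed

text \<open>The basis vectors of y are matched one by one. With p of them matched, Re <z_a, y_a> is
  maximised; at a maximum y_a is orthogonal to every basis vector of z except z_a, hence is a unit
  multiple of z_a, and a phase change finishes.\<close>

lemma linked_agreeing:
  fixes x y :: "nat \<Rightarrow> 'a::complex_inner"
  assumes x: "x \<in> tight2 {1..2 * n}" "paired n x" and y: "y \<in> tight2 {1..2 * n}" "paired n y"
    and "p \<le> n"
  shows "\<exists>z. linked {1..2 * n} x z \<and> paired n z \<and> (\<forall>q<p. z (2 * q + 1) = y (2 * q + 1))"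
  using assms(5)
proof (induction p)
  case 0
  then show ?case
    using linked_refl[OF x(1)] x(2) by auto
next
  case (Suc p)
  let ?I = "{1..2 * n}" and ?a = "2 * p + 1"
  have pn: "p < n" using Suc by simp
  then have aI: "?a \<in> ?I" "?a + 1 \<in> ?I" by auto
  obtain z0 where z0: "linked ?I x z0" "paired n z0" "\<forall>q<p. z0 (2 * q + 1) = y (2 * q + 1)"
    using Suc by auto
  define C :: "(nat \<Rightarrow> 'a) set" where "C = {x \<in> tight2 ?I. paired n x \<and> (\<forall>q<p. x (2 * q + 1) = y (2 * q + 1))}"
  have "closedin (tight2_topology ?I) C"
    unfolding C_def using pn by (intro closedin_agreeing) simp
  moreover have "z0 \<in> C"
    using z0 linked_in_tight2 by (auto simp: C_def)
  moreover have "continuous_map (tight2_topology ?I) euclidean (\<lambda>x. cinner (x ?a) (y ?a))"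
    using aI by (intro continuous_map_bilinear[OF bounded_bilinear_cinner] continuous_map_component) auto
  then have "continuous_map (tight2_topology ?I) euclideanreal (\<lambda>x. Re (cinner (x ?a) (y ?a)))"
    by (auto simp: continuous_map_atin intro: tendsto_Re)
  ultimately obtain z where z: "z \<in> C" "linked ?I z0 z"
    and max: "\<And>v. v \<in> C \<Longrightarrow> linked ?I z0 v \<Longrightarrow> Re (cinner (v ?a) (y ?a)) \<le> Re (cinner (z ?a) (y ?a))"
    by (rule linked_maximizer[OF finite_atLeastAtMost]) blast
  have zt: "z \<in> tight2 ?I" and zp: "paired n z" and zy: "\<And>q. q < p \<Longrightarrow> z (2 * q + 1) = y (2 * q + 1)"
    using z(1) by (auto simp: C_def)
  have orth: "cinner (z (2 * q + 1)) (y ?a) = 0" if q: "q < n" "q \<noteq> p" for q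
  proof (cases "q < p")
    case True
    then show ?thesis
      using paired_orthogonal[OF y q(1) pn q(2)] unfolding zy[OF True] by simp
  next
    case False
    let ?j = "2 * q + 1"
    have jI: "?j \<in> ?I" "?j + 1 \<in> ?I" using q by auto
    have ne: "?a \<noteq> ?j" "?a + 1 \<noteq> ?j + 1" "?a \<noteq> ?j + 1" "?a + 1 \<noteq> ?j"
      using q by auto
    have az: "cinner (z ?a) (z ?j) = 0"
      using paired_orthogonal[OF zt zp pn q(1)] q(2) by simp
    have dbl: "z (?a + 1) = z ?a" "z (?j + 1) = z ?j"
      using zp pn q(1) by (auto simp: paired_def)
    \<comment> \<open>As z_a and z_j are orthogonal, every phase is rotatable; this one makes w
      <z_j, y_a> nonnegative. The value 1 covers the zero case, where \<open>sgn\<close> is not a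
      unit.\<close>
    define w where "w = (if cinner (z ?j) (y ?a) = 0 then 1 else cnj (sgn (cinner (z ?j) (y ?a))))"
    have w: "cmod w = 1" "w * cinner (z ?j) (y ?a) = cmod (cinner (z ?j) (y ?a))"
      by (auto simp: w_def norm_sgn cnj_sgn_mult)
    have "c * Re (cinner (z ?a) (y ?a)) + s * cmod (cinner (z ?j) (y ?a)) \<le> Re (cinner (z ?a) (y ?a))"
      if cs: "c\<^sup>2 + s\<^sup>2 = 1" for c s
    proof -
      \<comment> \<open>The two copies of each vector are rotated one after the other with the same
        parameters, so that equality within pairs is restored at the end. The copies not yet rotated
        are still orthogonal, which makes the second rotation admissible.\<close>
      define z1 where "z1 = rot ?a ?j c s w z"
      define z2 where "z2 = rot (?a + 1) (?j + 1) c s w z1"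
      have l1: "linked ?I z z1"
        unfolding z1_def using az w(1) by (intro linked_rot zt aI jI ne cs) (auto simp: rotatable_def)
      have z1: "z1 (?a + 1) = z ?a" "z1 (?j + 1) = z ?j"
        using ne dbl by (auto simp: z1_def rot_def)
      have l2: "linked ?I z1 z2"
        unfolding z2_def using az w(1) z1 linked_in_tight2[OF l1]
        by (intro linked_rot aI jI ne cs) (auto simp: rotatable_def)
      have z2a: "z2 ?a = c *\<^sub>C z ?a + (w * s) *\<^sub>C z ?j"
        using ne by (auto simp: z2_def z1_def rot_def)
      have z2a': "z2 (?a + 1) = z2 ?a" "z2 (?j + 1) = z2 ?j"
        using ne z1 unfolding z2_def by (auto simp: rot_def) (auto simp: z1_def rot_def)
      have z2o: "z2 k = z k" if "k \<notin> {?a, ?a + 1, ?j, ?j + 1}" for k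
        using that by (auto simp: z2_def z1_def rot_def)
      have "z2 (2 * r + 2) = z2 (2 * r + 1)" if "r < n" for r
      proof (cases "r = p \<or> r = q")
        case True
        then show ?thesis using z2a' by auto
      next
        case False
        then have "2 * r + 2 \<notin> {?a, ?a + 1, ?j, ?j + 1}" "2 * r + 1 \<notin> {?a, ?a + 1, ?j, ?j + 1}"
          by auto
        then show ?thesis
          using zp that by (simp add: z2o paired_def)
      qed
      moreover have "z2 (2 * r + 1) = y (2 * r + 1)" if "r < p" for r
      proof -
        have "2 * r + 1 \<notin> {?a, ?a + 1, ?j, ?j + 1}"
          using that \<open>\<not> q < p\<close> by auto
        then show ?thesis using zy[OF that] by (simp add: z2o)
      qed
      ultimately have "z2 \<in> C"
        using linked_in_tight2[OF l2] by (auto simp: C_def paired_def)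
      moreover have "linked ?I z0 z2"
        by (intro connected_component_of_trans[OF z(2)] connected_component_of_trans[OF l1 l2])
      ultimately have "Re (cinner (z2 ?a) (y ?a)) \<le> Re (cinner (z ?a) (y ?a))"
        by (rule max)
      moreover have "cinner (z2 ?a) (y ?a) = c * cinner (z ?a) (y ?a) + s * (w * cinner (z ?j) (y ?a))"
        unfolding z2a by (simp add: cinner_add_left cinner_scaleC_left)
      ultimately show ?thesis
        unfolding w(2) by simp
    qed
    then have "cmod (cinner (z ?j) (y ?a)) = 0"
      by (rule linear_circle_maximum)
    then show ?thesis by simp
  qed
  have orth': "cinner (y ?a) (z k) = 0" if k: "k \<in> ?I - {?a, ?a + 1}" for k
  proof -
    have "k \<in> ?I" using k by blast
    then obtain q where q: "q < n" "k = 2 * q + 1 \<or> k = 2 * q + 2"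
      by (rule cases_odd_even)
    moreover have "z k = z (2 * q + 1)"
      using q zp by (auto simp: paired_def)
    moreover have "q \<noteq> p"
      using q(2) k by auto
    ultimately have "cinner (z k) (y ?a) = 0"
      using orth[of q] by simp
    then show ?thesis
      by (subst cinner_commute) simp
  qed
  define \<gamma> where "\<gamma> = cinner (y ?a) (z ?a)"
  have dbl: "z (?a + 1) = z ?a"
    using zp pn by (auto simp: paired_def)
  \<comment> \<open>In the frame expansion of y_a only the two equal terms of pair p survive, which
    cancels the frame bound 2.\<close>
  have "2 *\<^sub>C y ?a = (\<Sum>k\<in>?I. cinner (y ?a) (z k) *\<^sub>C z k)"
    using zt by (simp add: tight2_def)
  also have "\<dots> = (\<Sum>k\<in>{?a, ?a + 1}. cinner (y ?a) (z k) *\<^sub>C z k)"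
    using aI orth' by (intro sum.mono_neutral_right) auto
  also have "\<dots> = 2 *\<^sub>C (\<gamma> *\<^sub>C z ?a)"
    using dbl scaleC_add_left[of 1 1 "\<gamma> *\<^sub>C z ?a"] by (simp add: \<gamma>_def scaleC_one)
  finally have ya: "y ?a = \<gamma> *\<^sub>C z ?a"
    by (simp only: complex_vector.scale_cancel_left) simp
  have "norm (y ?a) = 1" "norm (z ?a) = 1"
    using y zt aI by (auto simp: tight2_def)
  then have \<gamma>: "cmod \<gamma> = 1"
    using ya by (simp add: norm_scaleC)
  define v where "v = rephase ?I (\<lambda>k. if k \<in> {?a, ?a + 1} then \<gamma> else 1) z"
  have l: "linked ?I z v"
    unfolding v_def using \<gamma> by (intro linked_rephase zt) auto
  have va: "v ?a = y ?a" "v (?a + 1) = y ?a"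
    using aI dbl ya by (simp_all add: v_def rephase_def)
  have vo: "v k = z k" if "k \<in> ?I - {?a, ?a + 1}" for k
    using that by (auto simp: v_def rephase_def scaleC_one)
  have "v (2 * q + 2) = v (2 * q + 1)" if "q < n" for q
  proof (cases "q = p")
    case False
    then have "2 * q + 2 \<in> ?I - {?a, ?a + 1}" "2 * q + 1 \<in> ?I - {?a, ?a + 1}"
      using that by auto
    then show ?thesis using vo zp that by (simp add: paired_def)
  qed (use va in auto)
  moreover have "v (2 * q + 1) = y (2 * q + 1)" if "q < Suc p" for q
  proof (cases "q = p")
    case False
    then have "2 * q + 1 \<in> ?I - {?a, ?a + 1}"
      using that pn by auto
    then show ?thesis using vo zy[of q] that False by simp
  qed (use va in auto)
  moreover have "linked ?I x v"
    by (intro connected_component_of_trans[OF z0(1)] connected_component_of_trans[OF z(2) l])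
  ultimately show ?case
    unfolding paired_def by blast
qed

section \<open>Connectedness of the frame space\<close>

lemma linked_all:
  fixes n :: nat
  assumes "x \<in> tight2 {1..2 * n}" "y \<in> tight2 {1..2 * n}"
  shows "linked {1..2 * n} x y"
proof -
  let ?I = "{1..2 * n}"
  obtain x' where x': "linked ?I x x'" "paired n x'"
    using linked_paired[OF assms(1)] by blast
  obtain y' where y': "linked ?I y y'" "paired n y'"
    using linked_paired[OF assms(2)] by blast
  have t: "x' \<in> tight2 ?I" "y' \<in> tight2 ?I"
    using x' y' linked_in_tight2 by blast+
  obtain z where z: "linked ?I x' z" "paired n z" "\<forall>q<n. z (2 * q + 1) = y' (2 * q + 1)"
    using linked_agreeing[OF t(1) x'(2) t(2) y'(2) order_refl] by blast
  have "z k = y' k" if k: "k \<in> ?I" for k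
  proof -
    obtain q where "q < n" "k = 2 * q + 1 \<or> k = 2 * q + 2"
      using cases_odd_even[OF k] .
    then show ?thesis
      using z y'(2) by (auto simp: paired_def)
  qed
  moreover have "z \<in> extensional ?I" "y' \<in> extensional ?I"
    using linked_in_tight2[OF z(1)] t(2) by (auto simp: tight2_def PiE_def)
  ultimately have "z = y'"
    by (intro extensionalityI[of z ?I y']) auto
  moreover have "linked ?I y' y"
    using y'(1) by (simp only: connected_component_of_sym)
  ultimately show ?thesis
    using connected_component_of_trans[OF x'(1)] connected_component_of_trans[OF z(1)] by blast
qed

text \<open>The dimension and n >= 1 enter here, through n / (2n) = 1/2.\<close>

lemma unit_norm_tight_frames_eq_tight2:
  fixes n :: nat
  assumes "n \<ge> 1" "complex_dim (UNIV :: 'a::complex_hilbert set) = n"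
  shows "(unit_norm_tight_frames (2 * n) :: (nat \<Rightarrow> 'a) set) = tight2 {1..2 * n}"
proof -
  have half: "of_nat n / of_nat (2 * n) = (1/2 :: complex)"
    using assms(1) by simp
  have "y = (1/2) *\<^sub>C S \<longleftrightarrow> S = 2 *\<^sub>C y" for y S :: 'a
    by (auto simp: scaleC_scaleC scaleC_one)
  then show ?thesis
    by (simp add: unit_norm_tight_frames_def tight2_def assms(2) half)
qed

theorem mainTheorem4:
  fixes n :: nat
  assumes "n \<ge> 1"
    and "complex_dim (UNIV :: 'a::complex_hilbert set) = n"
  shows "connectedin (product_topology (\<lambda>_. euclidean) {1..2 * n})
           (unit_norm_tight_frames (2 * n) :: (nat \<Rightarrow> 'a) set)"
  unfolding unit_norm_tight_frames_eq_tight2[OF assms] connectedin_def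
proof
  show "tight2 {1..2 * n} \<subseteq> topspace (power_topology {1..2 * n} :: (nat \<Rightarrow> 'a) topology)"
    by (auto simp: tight2_def)
  show "connected_space (tight2_topology {1..2 * n} :: (nat \<Rightarrow> 'a) topology)"
    unfolding connected_space_iff_connected_component topspace_tight2
    using linked_all by blast
qed

end
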